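(* Consider the Gaussian sequence model with parameter space $$\Theta^A(k_n,\tau_n)=\{\theta\in\mathbb R^n:\ \|\theta\|_0\le k_n,\ \|\theta\|_2^2\le k_n\tau_n^2,\ \|\theta\|_\infty\le A\tau_n\},$$ and let $\epsilon_n=k_n/n$, $\mu_n=\tau_n/\sigma_n$. Suppose $\epsilon_n\to0$, $\mu_n\to\infty$ and $\mu_n=o(\sqrt{\log\epsilon_n^{-1}})$ as $n\to\infty$. Then for any constant $A>1$, $$R(\Theta^A(k_n,\tau_n),\sigma_n)=n\sigma_n^2\left(\epsilon_n\mu_n^2-\tfrac12\epsilon_n^2\mu_n^2e^{\mu_n^2}(1+o(1))\right).$$
   Context: Model: for each $n$, one observes $y=(y_1,\dots,y_n)$ with $y_i=\theta_i+\sigma_n z_i$, where $z_i$ are i.i.d. $\mathcal N(0,1)$, $\sigma_n>0$ is known and $\theta\in\mathbb R^n$ is unknown; $1\le k_n\le n$ are integers and $\tau_n>0$. $\|\theta\|_0$ is the number of nonzero coordinates of $\theta$ and $\|\theta\|_\infty=\max_i|\theta_i|$. The minimax risk over a set $\Theta\subset\mathbb R^n$ is $R(\Theta,\sigma_n)=\inf_{\hat\theta}\sup_{\theta\in\Theta}\mathbb E_\theta\|\hat\theta-\theta\|_2^2$, the infimum being over all estimators (measurable functions of $y$). Here $o(1)$ denotes a sequence tending to $0$ as $n\to\infty$, and $a_n=o(b_n)$ means $a_n/b_n\to 0$. *)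

theory Defs
  imports "HOL-Probability.Probability"
begin

text \<open>A vector of \<open>\<real>\<^sup>n\<close> is an extensional function on \<open>{1..n}\<close>, i.e. a point of
  \<open>PiM {1..n} (\<lambda>_. borel)\<close>, so that \<open>n\<close> can vary along a sequence.\<close>

definition std_gaussian :: "nat \<Rightarrow> (nat \<Rightarrow> real) measure" where
  "std_gaussian n = PiM {1..n} (\<lambda>_. density lborel (\<lambda>x. ennreal (std_normal_density x)))"

definition observation_law :: "nat \<Rightarrow> real \<Rightarrow> (nat \<Rightarrow> real) \<Rightarrow> (nat \<Rightarrow> real) measure" where
  "observation_law n \<sigma> \<theta> =
     distr (std_gaussian n) (PiM {1..n} (\<lambda>_. borel)) (\<lambda>z. \<lambda>i\<in>{1..n}. \<theta> i + \<sigma> * z i)"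

definition estimators :: "nat \<Rightarrow> ((nat \<Rightarrow> real) \<Rightarrow> nat \<Rightarrow> real) set" where
  "estimators n = PiM {1..n} (\<lambda>_. borel) \<rightarrow>\<^sub>M PiM {1..n} (\<lambda>_. borel)"

text \<open>Risks take values in \<^typ>\<open>ennreal\<close>, since an estimator may have infinite mean squared
  error or unbounded risk.\<close>

definition risk ::
    "nat \<Rightarrow> real \<Rightarrow> ((nat \<Rightarrow> real) \<Rightarrow> nat \<Rightarrow> real) \<Rightarrow> (nat \<Rightarrow> real) \<Rightarrow> ennreal" where
  "risk n \<sigma> T \<theta> = (\<integral>\<^sup>+ y. ennreal (\<Sum>i\<in>{1..n}. (T y i - \<theta> i)\<^sup>2) \<partial>observation_law n \<sigma> \<theta>)"

definition minimax_risk :: "nat \<Rightarrow> (nat \<Rightarrow> real) set \<Rightarrow> real \<Rightarrow> ennreal" where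
  "minimax_risk n \<Theta> \<sigma> = (INF T\<in>estimators n. SUP \<theta>\<in>\<Theta>. risk n \<sigma> T \<theta>)"

definition l0_norm :: "nat \<Rightarrow> (nat \<Rightarrow> real) \<Rightarrow> nat" where
  "l0_norm n \<theta> = card {i\<in>{1..n}. \<theta> i \<noteq> 0}"

text \<open>Meaningful only for \<open>n \<ge> 1\<close>.\<close>

definition sup_norm :: "nat \<Rightarrow> (nat \<Rightarrow> real) \<Rightarrow> real" where
  "sup_norm n \<theta> = Max ((\<lambda>i. \<bar>\<theta> i\<bar>) ` {1..n})"

definition sparse_space :: "real \<Rightarrow> nat \<Rightarrow> nat \<Rightarrow> real \<Rightarrow> (nat \<Rightarrow> real) set" where
  "sparse_space A n k \<tau> =
     {\<theta> \<in> {1..n} \<rightarrow>\<^sub>E UNIV.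
        l0_norm n \<theta> \<le> k \<and> (\<Sum>i\<in>{1..n}. (\<theta> i)\<^sup>2) \<le> real k * \<tau>\<^sup>2 \<and> sup_norm n \<theta> \<le> A * \<tau>}"

end

theory Submission
  imports Defs
begin

text \<open>
  Upper bound: the coordinatewise rule \<open>\<epsilon> \<tau> exp (- \<mu>\<^sup>2 / 2) sinh (\<mu> y\<^sub>i / \<sigma>)\<close>, the linearization in
  \<open>\<epsilon>\<close> of the posterior mean under the two-point prior \<open>\<plusminus>\<tau>\<close> with sparsity \<open>\<epsilon>\<close>, has an explicit risk. Pure
  noise costs \<open>\<epsilon>\<^sup>2 \<mu>\<^sup>2 exp (\<mu>\<^sup>2) / 2\<close> per coordinate; the gain on a signal coordinate, proportional to
  \<open>x sinh x\<close> at \<open>x = \<mu> \<theta>\<^sub>i / \<sigma>\<close>, is convex in \<open>x\<^sup>2\<close>, so the worst split of the quadratic budget is the even one: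
  \<open>k\<close> coordinates of size \<open>\<tau>\<close>. The bound on the sup norm keeps the variance on the signal
  coordinates, of relative order \<open>\<epsilon> exp (2 A \<mu>\<^sup>2)\<close>, negligible.

  Lower bound: put \<open>k\<close> independent spikes \<open>\<plusminus>\<tau>\<close>, each at a uniform position in its own block of length
  \<open>m = n div k\<close>. Under the noise measure the Bayes risk of a block is \<open>\<tau>\<^sup>2 (1 - E (\<Sum> s\<^sub>i\<^sup>2 / (m \<Sum> c\<^sub>i)))\<close> with
  \<open>c\<^sub>i\<close>, \<open>s\<^sub>i\<close> the even and odd parts of the likelihood ratio, and \<open>\<Sum> c\<^sub>i\<close> concentrates at \<open>m\<close>
  because \<open>exp (\<mu>\<^sup>2)\<close> is \<open>m\<close> to the power \<open>o(1)\<close>.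
\<close>

section \<open>Gaussian moments and translations\<close>

abbreviation gauss :: "real measure" where
  "gauss \<equiv> density lborel (\<lambda>x. ennreal (std_normal_density x))"

lemma prob_space_gauss: "prob_space gauss"
  by (rule prob_space_normal_density) simp

lemma product_sigma_finite_gauss: "product_sigma_finite (\<lambda>_::nat. gauss)"
  by (intro product_sigma_finite.intro prob_space_imp_sigma_finite prob_space_gauss)

lemma has_bochner_integral_gauss_const: "has_bochner_integral gauss (\<lambda>_. c) (c :: real)"
proof -
  interpret prob_space gauss by (rule prob_space_gauss)
  show ?thesis
    using prob_space by (simp add: has_bochner_integral_iff)
qed

lemma std_normal_density_exp_shift:
  "std_normal_density (x - a) = std_normal_density x * exp (a * x - a\<^sup>2 / 2)"
  unfolding std_normal_density_def
  by (simp add: power2_eq_square field_simps flip: exp_add)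

lemma has_bochner_integral_gauss_exp:
  "has_bochner_integral gauss (\<lambda>x. exp (a * x)) (exp (a\<^sup>2 / 2))"
proof (rule has_bochner_integral_density)
  have eq: "std_normal_density x *\<^sub>R exp (a * x) = exp (a\<^sup>2 / 2) * normal_density a 1 x" for x
    unfolding normal_density_def
    by (simp add: power2_eq_square field_simps flip: exp_add)
  have "has_bochner_integral lborel (normal_density a 1) 1"
    by (simp add: has_bochner_integral_iff)
  from has_bochner_integral_mult_right[OF this, of "exp (a\<^sup>2 / 2)"]
  show "has_bochner_integral lborel (\<lambda>x. std_normal_density x *\<^sub>R exp (a * x)) (exp (a\<^sup>2 / 2))"
    unfolding eq by simp
qed auto

text \<open>Cameron-Martin formula in dimension one: an affine substitution moves the shift from the
  integrand to the density, where it becomes an exponential weight. Nonnegative integrals are used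
  because the loss of an arbitrary estimator may fail to be integrable.\<close>

lemma nn_integral_gauss_shift:
  assumes [measurable]: "f \<in> borel_measurable borel"
  shows "(\<integral>\<^sup>+x. f (x + a) \<partial>gauss) = (\<integral>\<^sup>+x. f x * ennreal (exp (a * x - a\<^sup>2 / 2)) \<partial>gauss)"
proof -
  have "(\<integral>\<^sup>+x. f (x + a) \<partial>gauss) = (\<integral>\<^sup>+x. ennreal (std_normal_density x) * f (x + a) \<partial>lborel)"
    by (subst nn_integral_density) auto
  also have "\<dots> = (\<integral>\<^sup>+x. ennreal (std_normal_density (x - a)) * f x \<partial>lborel)"
    using nn_integral_real_affine[of "\<lambda>x. ennreal (std_normal_density (x - a)) * f x" 1 a]
    by (simp add: add.commute)
  also have "\<dots> = (\<integral>\<^sup>+x. f x * ennreal (exp (a * x - a\<^sup>2 / 2)) \<partial>gauss)"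
    by (subst nn_integral_density)
      (auto simp: std_normal_density_exp_shift ennreal_mult' mult_ac intro!: nn_integral_cong)
  finally show ?thesis .
qed

section \<open>Coordinate shifts and product integrals under the noise measure\<close>

lemma sets_std_gaussian [measurable_cong]:
  "sets (std_gaussian n) = sets (PiM {1..n} (\<lambda>_. borel))"
  unfolding std_gaussian_def by (intro sets_PiM_cong) auto

lemma prob_space_std_gaussian: "prob_space (std_gaussian n)"
  unfolding std_gaussian_def by (intro prob_space_PiM prob_space_gauss)

text \<open>Fubini isolates coordinate \<open>i\<close>, where the one-dimensional formula applies.
  This puts the risks at all spike positions under one common noise measure, with likelihood ratios
  as weights.\<close>

lemma nn_integral_std_gaussian_shift:
  assumes i: "i \<in> {1..n}" and f[measurable]: "f \<in> borel_measurable (std_gaussian n)"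
  shows "(\<integral>\<^sup>+z. f (z(i := z i + a)) \<partial>std_gaussian n) =
    (\<integral>\<^sup>+z. f z * ennreal (exp (a * z i - a\<^sup>2 / 2)) \<partial>std_gaussian n)"
proof -
  interpret product_sigma_finite "\<lambda>_::nat. gauss" by (rule product_sigma_finite_gauss)
  let ?I = "{1..n} - {i}"
  have ins: "insert i ?I = {1..n}" using i by auto
  have f': "f \<in> borel_measurable (PiM {1..n} (\<lambda>_. gauss))"
    using f by (simp add: std_gaussian_def)
  have f_upd: "(\<lambda>y. f (x(i := y))) \<in> borel_measurable borel" if "x \<in> space (PiM ?I (\<lambda>_. gauss))" for x
  proof -
    have "(\<lambda>y. x(i := y)) \<in> gauss \<rightarrow>\<^sub>M PiM {1..n} (\<lambda>_. gauss)"
      using that i by (intro measurable_PiM_single') (auto simp: space_PiM PiE_def extensional_def)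
    from measurable_compose[OF this f'] show ?thesis by simp
  qed
  have upd: "(\<lambda>z. z(i := z i + a)) \<in> std_gaussian n \<rightarrow>\<^sub>M std_gaussian n"
    unfolding std_gaussian_def
    using i by (intro measurable_PiM_single') (auto simp: space_PiM PiE_def extensional_def)
  have m1: "(\<lambda>z. f (z(i := z i + a))) \<in> borel_measurable (PiM (insert i ?I) (\<lambda>_. gauss))"
    using measurable_compose[OF upd f] unfolding ins by (simp add: std_gaussian_def)
  have m2: "(\<lambda>z. f z * ennreal (exp (a * z i - a\<^sup>2 / 2))) \<in> borel_measurable (PiM (insert i ?I) (\<lambda>_. gauss))"
    using i f' unfolding ins by measurable
  have "(\<integral>\<^sup>+z. f (z(i := z i + a)) \<partial>std_gaussian n) =
      (\<integral>\<^sup>+x. (\<integral>\<^sup>+y. f (x(i := y + a)) \<partial>gauss) \<partial>PiM ?I (\<lambda>_. gauss))"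
    using product_nn_integral_insert[OF _ _ m1, unfolded ins] by (simp add: std_gaussian_def)
  also have "\<dots> = (\<integral>\<^sup>+x. (\<integral>\<^sup>+y. f (x(i := y)) * ennreal (exp (a * y - a\<^sup>2 / 2)) \<partial>gauss) \<partial>PiM ?I (\<lambda>_. gauss))"
    by (intro nn_integral_cong nn_integral_gauss_shift f_upd)
  also have "\<dots> = (\<integral>\<^sup>+z. f z * ennreal (exp (a * z i - a\<^sup>2 / 2)) \<partial>std_gaussian n)"
    using product_nn_integral_insert[OF _ _ m2, unfolded ins] by (simp add: std_gaussian_def)
  finally show ?thesis .
qed

text \<open>Independence of the coordinates; those outside \<open>J\<close> receive the constant
  factor 1, so that the product formula over all of \<open>{1..n}\<close> applies.\<close>

lemma has_bochner_integral_std_gaussian_prod: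
  fixes f :: "nat \<Rightarrow> real \<Rightarrow> real"
  assumes J: "J \<subseteq> {1..n}" and f: "\<And>j. j \<in> J \<Longrightarrow> has_bochner_integral gauss (f j) (c j)"
  shows "has_bochner_integral (std_gaussian n) (\<lambda>z. \<Prod>j\<in>J. f j (z j)) (\<Prod>j\<in>J. c j)"
proof -
  interpret product_sigma_finite "\<lambda>_::nat. gauss" by (rule product_sigma_finite_gauss)
  let ?f = "\<lambda>j. if j \<in> J then f j else (\<lambda>_. 1)"
  have int: "integrable gauss (?f j)" for j
    using f has_bochner_integral_gauss_const[of 1] by (auto simp: has_bochner_integral_iff)
  have eq: "(\<Prod>j\<in>{1..n}. ?f j (z j)) = (\<Prod>j\<in>J. f j (z j))" for z
    using J by (intro prod.mono_neutral_cong_right) auto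
  have "(\<Prod>j\<in>{1..n}. integral\<^sup>L gauss (?f j)) = (\<Prod>j\<in>J. c j)"
    using J f has_bochner_integral_gauss_const[of 1]
    by (intro prod.mono_neutral_cong_right) (auto simp: has_bochner_integral_iff)
  moreover have "integrable (std_gaussian n) (\<lambda>z. \<Prod>j\<in>{1..n}. ?f j (z j))"
    unfolding std_gaussian_def by (intro product_integrable_prod int) auto
  moreover have "integral\<^sup>L (std_gaussian n) (\<lambda>z. \<Prod>j\<in>{1..n}. ?f j (z j)) = (\<Prod>j\<in>{1..n}. integral\<^sup>L gauss (?f j))"
    unfolding std_gaussian_def by (intro product_integral_prod int) auto
  ultimately show ?thesis unfolding eq has_bochner_integral_iff by simp
qed

section \<open>Even and odd parts of the likelihood ratio and their moments\<close>

definition cosh_lr :: "real \<Rightarrow> real \<Rightarrow> real" where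
  "cosh_lr \<mu> x = exp (- \<mu>\<^sup>2 / 2) * cosh (\<mu> * x)"

text \<open>\<open>cosh_lr\<close> and \<open>sinh_lr\<close> are half the sum and half the
  difference of the likelihood ratios of the unit-variance normal laws with means
  \<open>\<mu>\<close> and \<open>- \<mu>\<close> against the standard normal law.\<close>

definition sinh_lr :: "real \<Rightarrow> real \<Rightarrow> real" where
  "sinh_lr \<mu> x = exp (- \<mu>\<^sup>2 / 2) * sinh (\<mu> * x)"

lemma has_bochner_integral_cosh_lr: "has_bochner_integral gauss (cosh_lr \<mu>) 1"
proof -
  have "has_bochner_integral gauss
      (\<lambda>x. exp (- \<mu>\<^sup>2 / 2) * ((exp (\<mu> * x) + exp ((-\<mu>) * x)) / 2))
      (exp (- \<mu>\<^sup>2 / 2) * ((exp (\<mu>\<^sup>2 / 2) + exp ((-\<mu>)\<^sup>2 / 2)) / 2))"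
    by (intro has_bochner_integral_mult_right has_bochner_integral_divide_zero
        has_bochner_integral_add has_bochner_integral_gauss_exp)
  then show ?thesis
    by (simp add: cosh_lr_def[abs_def] cosh_def flip: exp_add)
qed

text \<open>The value is the chi-square divergence of the symmetric two-point mixture from the
  standard normal law; it controls how averages of \<open>cosh_lr\<close> concentrate at 1.\<close>

lemma has_bochner_integral_cosh_lr_sq:
  "has_bochner_integral gauss (\<lambda>x. (cosh_lr \<mu> x - 1)\<^sup>2) (cosh (\<mu>\<^sup>2) - 1)"
proof -
  have eq: "(cosh_lr \<mu> x - 1)\<^sup>2 =
      exp (- \<mu>\<^sup>2) * ((exp ((2*\<mu>) * x) + exp (- (2*\<mu>) * x) + 2) / 4) - 2 * cosh_lr \<mu> x + 1" for x
  proof -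
    have "(exp (\<mu> * x) + exp (- (\<mu> * x)))\<^sup>2 = exp ((2*\<mu>) * x) + exp (- (2*\<mu>) * x) + 2"
      by (simp add: power2_eq_square algebra_simps flip: exp_add)
    moreover have "(exp (- \<mu>\<^sup>2 / 2))\<^sup>2 = exp (- \<mu>\<^sup>2)"
      by (simp add: power2_eq_square flip: exp_add)
    moreover have "(cosh_lr \<mu> x)\<^sup>2 = (exp (- \<mu>\<^sup>2 / 2))\<^sup>2 * ((exp (\<mu> * x) + exp (- (\<mu> * x)))\<^sup>2 / 4)"
      by (simp add: cosh_lr_def cosh_def power_mult_distrib power_divide)
    ultimately have "(cosh_lr \<mu> x)\<^sup>2 = exp (- \<mu>\<^sup>2) * ((exp ((2*\<mu>) * x) + exp (- (2*\<mu>) * x) + 2) / 4)"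
      by simp
    then show ?thesis by (simp add: power2_diff)
  qed
  have "has_bochner_integral gauss (\<lambda>x. (cosh_lr \<mu> x - 1)\<^sup>2)
      (exp (- \<mu>\<^sup>2) * ((exp ((2*\<mu>)\<^sup>2 / 2) + exp ((- (2*\<mu>))\<^sup>2 / 2) + 2) / 4) - 2 * 1 + 1)"
    unfolding eq
    by (intro has_bochner_integral_mult_right has_bochner_integral_divide_zero has_bochner_integral_diff
        has_bochner_integral_add has_bochner_integral_gauss_exp has_bochner_integral_cosh_lr has_bochner_integral_gauss_const)
  moreover have "exp (- \<mu>\<^sup>2) * ((exp ((2*\<mu>)\<^sup>2 / 2) + exp ((- (2*\<mu>))\<^sup>2 / 2) + 2) / 4) - 2 * 1 + 1 = cosh (\<mu>\<^sup>2) - 1"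
    by (simp add: cosh_def power_mult_distrib field_simps flip: exp_add)
  ultimately show ?thesis by simp
qed

lemma has_bochner_integral_sinh_lr_sq_shift:
  "has_bochner_integral gauss (\<lambda>x. (sinh_lr \<mu> (x + t))\<^sup>2)
     ((exp (\<mu>\<^sup>2) * cosh (2 * \<mu> * t) - exp (- \<mu>\<^sup>2)) / 2)"
proof -
  have eq: "(sinh_lr \<mu> (x + t))\<^sup>2 = exp (- \<mu>\<^sup>2) *
     ((exp (2 * \<mu> * t) * exp ((2*\<mu>) * x) + exp (- (2 * \<mu> * t)) * exp (- (2*\<mu>) * x) - 2) / 4)" for x
  proof -
    have "(exp (\<mu> * (x + t)) - exp (- (\<mu> * (x + t))))\<^sup>2 =
       exp (2 * \<mu> * t) * exp ((2*\<mu>) * x) + exp (- (2 * \<mu> * t)) * exp (- (2*\<mu>) * x) - 2"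
      by (simp add: power2_eq_square algebra_simps flip: exp_add)
    moreover have "(exp (- \<mu>\<^sup>2 / 2))\<^sup>2 = exp (- \<mu>\<^sup>2)"
      by (simp add: power2_eq_square flip: exp_add)
    moreover have "(sinh_lr \<mu> (x + t))\<^sup>2 = (exp (- \<mu>\<^sup>2 / 2))\<^sup>2 * ((exp (\<mu> * (x + t)) - exp (- (\<mu> * (x + t))))\<^sup>2 / 4)"
      by (simp add: sinh_lr_def sinh_def power_mult_distrib power_divide)
    ultimately show ?thesis by simp
  qed
  have "has_bochner_integral gauss (\<lambda>x. (sinh_lr \<mu> (x + t))\<^sup>2)
      (exp (- \<mu>\<^sup>2) * ((exp (2 * \<mu> * t) * exp ((2*\<mu>)\<^sup>2 / 2) + exp (- (2 * \<mu> * t)) * exp ((- (2*\<mu>))\<^sup>2 / 2) - 2) / 4))"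
    unfolding eq
    by (intro has_bochner_integral_mult_right has_bochner_integral_divide_zero has_bochner_integral_diff
        has_bochner_integral_add has_bochner_integral_gauss_exp has_bochner_integral_gauss_const)
  moreover have "exp (- \<mu>\<^sup>2) * ((exp (2 * \<mu> * t) * exp ((2*\<mu>)\<^sup>2 / 2) + exp (- (2 * \<mu> * t)) * exp ((- (2*\<mu>))\<^sup>2 / 2) - 2) / 4)
     = (exp (\<mu>\<^sup>2) * cosh (2 * \<mu> * t) - exp (- \<mu>\<^sup>2)) / 2"
    by (simp add: cosh_def power_mult_distrib field_simps flip: exp_add)
  ultimately show ?thesis by (simp only:)
qed

lemma has_bochner_integral_sinh_lr_shift:
  "has_bochner_integral gauss (\<lambda>x. sinh_lr \<mu> (x + t)) (sinh (\<mu> * t))"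
proof -
  have "has_bochner_integral gauss
      (\<lambda>x. exp (- \<mu>\<^sup>2 / 2) * ((exp (\<mu> * t) * exp (\<mu> * x) - exp (- (\<mu> * t)) * exp ((-\<mu>) * x)) / 2))
      (exp (- \<mu>\<^sup>2 / 2) * ((exp (\<mu> * t) * exp (\<mu>\<^sup>2 / 2) - exp (- (\<mu> * t)) * exp ((-\<mu>)\<^sup>2 / 2)) / 2))"
    by (intro has_bochner_integral_mult_right has_bochner_integral_divide_zero
        has_bochner_integral_diff has_bochner_integral_gauss_exp)
  moreover have "exp (- \<mu>\<^sup>2 / 2) * ((exp (\<mu> * t) * exp (\<mu> * x) - exp (- (\<mu> * t)) * exp ((-\<mu>) * x)) / 2) = sinh_lr \<mu> (x + t)" for x
  proof -
    have "exp (\<mu> * t) * exp (\<mu> * x) = exp (\<mu> * (x + t))" "exp (- (\<mu> * t)) * exp ((-\<mu>) * x) = exp (- (\<mu> * (x + t)))"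
      by (simp_all add: algebra_simps flip: exp_add)
    then show ?thesis by (simp add: sinh_lr_def sinh_def)
  qed
  moreover have "exp (- \<mu>\<^sup>2 / 2) * ((exp (\<mu> * t) * exp (\<mu>\<^sup>2 / 2) - exp (- (\<mu> * t)) * exp ((-\<mu>)\<^sup>2 / 2)) / 2) = sinh (\<mu> * t)"
    by (simp add: sinh_def field_simps flip: exp_add)
  ultimately show ?thesis by (simp only:)
qed

section \<open>The hyperbolic sine estimator\<close>

lemma risk_eq:
  assumes "T \<in> estimators n"
  shows "risk n \<sigma> T \<theta> =
    (\<integral>\<^sup>+z. ennreal (\<Sum>i\<in>{1..n}. (T (\<lambda>i\<in>{1..n}. \<theta> i + \<sigma> * z i) i - \<theta> i)\<^sup>2) \<partial>std_gaussian n)"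
proof -
  have T[measurable]: "(\<lambda>y. T y i) \<in> borel_measurable (PiM {1..n} (\<lambda>_. borel))" if "i \<in> {1..n}" for i
    using that assms unfolding estimators_def by measurable
  have aff: "(\<lambda>z. \<lambda>i\<in>{1..n}. \<theta> i + \<sigma> * z i) \<in> std_gaussian n \<rightarrow>\<^sub>M PiM {1..n} (\<lambda>_. borel)"
    by measurable
  show ?thesis
    unfolding risk_def observation_law_def
    by (subst nn_integral_distr[OF aff]) measurable
qed

text \<open>The second derivative of \<open>sinh\<close> is \<open>sinh\<close> itself, so
  \<open>sinh\<close> is convex on the nonnegative half-line; \<open>s > 0\<close> makes the point
  of tangency interior.\<close>

lemma sinh_above_tangent:
  fixes x s :: real
  assumes "x \<ge> 0" "s > 0"
  shows "sinh s + cosh s * (x - s) \<le> sinh x"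
proof -
  have "convex_on {0::real..} sinh"
    by (rule f''_ge0_imp_convex[where f'' = sinh])
      (auto intro!: derivative_eq_intros)
  then have "sinh x - sinh s \<ge> cosh s * (x - s)"
    using assms
    by (intro convex_on_imp_above_tangent[where A = "{0..}"])
       (auto intro!: derivative_eq_intros)
  then show ?thesis by simp
qed

lemma sinh_le_mult_cosh:
  fixes s :: real
  assumes "s > 0"
  shows "sinh s \<le> s * cosh s"
  using sinh_above_tangent[of 0 s] assms by (simp add: mult.commute)

text \<open>The slope is the derivative of \<open>x sinh x\<close> with respect to \<open>x\<^sup>2\<close> at \<open>x = s\<close>.\<close>

lemma mult_sinh_above_tangent:
  fixes x s :: real
  assumes "s > 0"
  shows "s * sinh s + (sinh s + s * cosh s) / (2 * s) * (x\<^sup>2 - s\<^sup>2) \<le> x * sinh x"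
proof -
  have main: "s * sinh s + (sinh s + s * cosh s) / (2 * s) * (x\<^sup>2 - s\<^sup>2) \<le> x * sinh x" if x: "x \<ge> 0" for x
  proof -
    have "x * (sinh s + cosh s * (x - s)) \<le> x * sinh x"
      using sinh_above_tangent[OF x assms] x by (intro mult_left_mono) auto
    \<comment> \<open>The two lower bounds differ by a square times
      \<open>s * cosh s - sinh s\<close>, which is nonnegative, so the bound linear in
      \<open>x\<^sup>2\<close> is the weaker one.\<close>
    moreover have "s * sinh s + (sinh s + s * cosh s) / (2 * s) * (x\<^sup>2 - s\<^sup>2) =
       x * (sinh s + cosh s * (x - s)) - (x - s)\<^sup>2 * (s * cosh s - sinh s) / (2 * s)"
      using assms by (simp add: field_simps power2_eq_square)
    moreover have "(x - s)\<^sup>2 * (s * cosh s - sinh s) / (2 * s) \<ge> 0"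
      using sinh_le_mult_cosh[OF assms] assms by simp
    ultimately show ?thesis by linarith
  qed
  \<comment> \<open>Both sides are even in \<open>x\<close>.\<close>
  show ?thesis
    using main[of "\<bar>x\<bar>"] by (cases "x \<ge> 0") auto
qed

text \<open>For \<open>c = \<epsilon> * \<tau>\<close> this is the numerator of the posterior mean
  under the two-point prior; the denominator
  \<open>1 - \<epsilon> + \<epsilon> * cosh_lr \<mu> (y i / \<sigma>)\<close> is replaced by
  1.\<close>

definition sinh_estimator :: "nat \<Rightarrow> real \<Rightarrow> real \<Rightarrow> real \<Rightarrow> (nat \<Rightarrow> real) \<Rightarrow> nat \<Rightarrow> real" where
  "sinh_estimator n \<sigma> \<mu> c y = (\<lambda>i\<in>{1..n}. c * sinh_lr \<mu> (y i / \<sigma>))"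

lemma borel_measurable_sinh_lr [measurable]: "sinh_lr \<mu> \<in> borel_measurable borel"
  unfolding sinh_lr_def[abs_def] sinh_def by measurable

lemma sinh_estimator_measurable: "sinh_estimator n \<sigma> \<mu> c \<in> estimators n"
  unfolding estimators_def sinh_estimator_def[abs_def] by measurable

text \<open>Expanding the square leaves only the first two moments of \<open>sinh_lr\<close> at a
  shifted Gaussian argument, and both are explicit.\<close>

lemma risk_sinh_estimator:
  assumes "\<sigma> > 0"
  shows "risk n \<sigma> (sinh_estimator n \<sigma> \<mu> c) \<theta> =
    ennreal (\<Sum>i\<in>{1..n}. c\<^sup>2 * ((exp (\<mu>\<^sup>2) * cosh (2 * \<mu> * (\<theta> i / \<sigma>)) - exp (- \<mu>\<^sup>2)) / 2)
       - 2 * c * \<theta> i * sinh (\<mu> * (\<theta> i / \<sigma>)) + (\<theta> i)\<^sup>2)" (is "_ = ennreal (\<Sum>i\<in>_. ?r i)")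
proof -
  have term_eq: "(c * sinh_lr \<mu> ((\<theta> i + \<sigma> * x) / \<sigma>) - \<theta> i)\<^sup>2 =
      c\<^sup>2 * (sinh_lr \<mu> (x + \<theta> i / \<sigma>))\<^sup>2 - 2 * c * \<theta> i * sinh_lr \<mu> (x + \<theta> i / \<sigma>) + (\<theta> i)\<^sup>2" for i x
  proof -
    have "(\<theta> i + \<sigma> * x) / \<sigma> = x + \<theta> i / \<sigma>" using assms by (simp add: field_simps)
    then show ?thesis by (simp add: power2_eq_square algebra_simps)
  qed
  have hb1: "has_bochner_integral gauss (\<lambda>x. (c * sinh_lr \<mu> ((\<theta> i + \<sigma> * x) / \<sigma>) - \<theta> i)\<^sup>2) (?r i)" for i
    unfolding term_eq
    by (intro has_bochner_integral_add has_bochner_integral_diff has_bochner_integral_mult_right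
        has_bochner_integral_sinh_lr_sq_shift has_bochner_integral_sinh_lr_shift has_bochner_integral_gauss_const)
  have hb: "has_bochner_integral (std_gaussian n) (\<lambda>z. (c * sinh_lr \<mu> ((\<theta> i + \<sigma> * z i) / \<sigma>) - \<theta> i)\<^sup>2) (?r i)"
    if "i \<in> {1..n}" for i
    using has_bochner_integral_std_gaussian_prod[of "{i}" n "\<lambda>i x. (c * sinh_lr \<mu> ((\<theta> i + \<sigma> * x) / \<sigma>) - \<theta> i)\<^sup>2" ?r]
      hb1 that by simp
  have "has_bochner_integral (std_gaussian n)
      (\<lambda>z. \<Sum>i\<in>{1..n}. (c * sinh_lr \<mu> ((\<theta> i + \<sigma> * z i) / \<sigma>) - \<theta> i)\<^sup>2) (\<Sum>i\<in>{1..n}. ?r i)"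
    by (intro has_bochner_integral_sum hb)
  then have "(\<integral>\<^sup>+z. ennreal (\<Sum>i\<in>{1..n}. (c * sinh_lr \<mu> ((\<theta> i + \<sigma> * z i) / \<sigma>) - \<theta> i)\<^sup>2) \<partial>std_gaussian n)
      = ennreal (\<Sum>i\<in>{1..n}. ?r i)"
    by (subst nn_integral_eq_integral) (auto simp: has_bochner_integral_iff intro!: sum_nonneg)
  moreover have "(\<Sum>i\<in>{1..n}. (sinh_estimator n \<sigma> \<mu> c (\<lambda>i\<in>{1..n}. \<theta> i + \<sigma> * z i) i - \<theta> i)\<^sup>2) =
      (\<Sum>i\<in>{1..n}. (c * sinh_lr \<mu> ((\<theta> i + \<sigma> * z i) / \<sigma>) - \<theta> i)\<^sup>2)" for z
    by (intro sum.cong) (auto simp: sinh_estimator_def)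
  ultimately show ?thesis
    unfolding risk_eq[OF sinh_estimator_measurable] by simp
qed

lemma abs_le_sup_norm: "i \<in> {1..n} \<Longrightarrow> \<bar>\<theta> i\<bar> \<le> sup_norm n \<theta>"
  unfolding sup_norm_def by (intro Max_ge) auto

text \<open>The estimator has scale \<open>c * \<tau>\<close>, with \<open>c\<close> later equal to
  \<epsilon>. Hypothesis \<open>small\<close> makes the slope of the linearized signal bound in
  \<open>(t i)\<^sup>2\<close> nonnegative, so that the quadratic budget can be inserted at its
  maximum.\<close>

lemma minimax_risk_sparse_le:
  fixes A c \<mu> \<tau> \<sigma> :: real and n k :: nat
  assumes \<sigma>: "\<sigma> > 0" and \<mu>: "\<mu> > 0" and \<tau>: "\<tau> = \<mu> * \<sigma>" and c: "c \<ge> 0"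
    and A: "A \<ge> 0"
    and small: "c * (sinh (\<mu>\<^sup>2) + \<mu>\<^sup>2 * cosh (\<mu>\<^sup>2)) \<le> 1"
  shows "minimax_risk n (sparse_space A n k \<tau>) \<sigma> \<le>
    ennreal (\<sigma>\<^sup>2 * (k * \<mu>\<^sup>2 - 2 * c * k * \<mu>\<^sup>2 * sinh (\<mu>\<^sup>2) +
      1/2 * c\<^sup>2 * \<mu>\<^sup>2 * exp (\<mu>\<^sup>2) * (n + k * exp (2 * A * \<mu>\<^sup>2))))"
proof -
  let ?s = "\<mu>\<^sup>2"
  let ?C = "(sinh ?s + ?s * cosh ?s) / 2"
  have s: "?s > 0" using \<mu> by simp
  have "risk n \<sigma> (sinh_estimator n \<sigma> \<mu> (c * \<tau>)) \<theta> \<le>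
    ennreal (\<sigma>\<^sup>2 * (k * \<mu>\<^sup>2 - 2 * c * k * \<mu>\<^sup>2 * sinh (\<mu>\<^sup>2) +
      1/2 * c\<^sup>2 * \<mu>\<^sup>2 * exp (\<mu>\<^sup>2) * (n + k * exp (2 * A * \<mu>\<^sup>2))))"
    if \<theta>: "\<theta> \<in> sparse_space A n k \<tau>" for \<theta>
  proof -
    define t where "t i = \<theta> i / \<sigma>" for i
    have \<theta>t: "\<theta> i = \<sigma> * t i" for i using \<sigma> by (simp add: t_def)
    define S where "S = {i\<in>{1..n}. \<theta> i \<noteq> 0}"
    have S: "S \<subseteq> {1..n}" "finite S" by (auto simp: S_def)
    have cardS: "card S \<le> k"
      using \<theta> by (simp add: sparse_space_def l0_norm_def S_def)
    have t0: "t i = 0" if "i \<in> {1..n} - S" for i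
      using that by (simp add: S_def t_def)
    have sum_t: "(\<Sum>i\<in>S. (t i)\<^sup>2) \<le> k * \<mu>\<^sup>2"
    proof -
      have "(\<Sum>i\<in>S. (t i)\<^sup>2) = (\<Sum>i\<in>{1..n}. (t i)\<^sup>2)"
        using S t0 by (intro sum.mono_neutral_left) auto
      also have "\<dots> = (\<Sum>i\<in>{1..n}. (\<theta> i)\<^sup>2) / \<sigma>\<^sup>2"
        by (simp add: t_def power_divide sum_divide_distrib)
      also have "\<dots> \<le> real k * \<tau>\<^sup>2 / \<sigma>\<^sup>2"
        using \<theta> by (intro divide_right_mono) (auto simp: sparse_space_def)
      also have "\<dots> = k * \<mu>\<^sup>2" using \<sigma> by (simp add: \<tau> power_mult_distrib)
      finally show ?thesis .
    qed
    have cosh_le: "cosh (2 * \<mu> * t i) \<le> exp (2 * A * \<mu>\<^sup>2)" if "i \<in> S" for i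
    proof -
      have "\<bar>\<theta> i\<bar> \<le> A * \<tau>"
        using abs_le_sup_norm[of i n \<theta>] \<theta> that S by (auto simp: sparse_space_def)
      then have "\<bar>t i\<bar> \<le> A * \<mu>"
        using \<sigma> by (simp add: t_def \<tau> field_simps)
      then have "2 * \<mu> * \<bar>t i\<bar> \<le> 2 * \<mu> * (A * \<mu>)"
        using \<mu> by (intro mult_left_mono) auto
      then have le: "\<bar>2 * \<mu> * t i\<bar> \<le> 2 * A * \<mu>\<^sup>2"
        using \<mu> by (simp add: abs_mult power2_eq_square mult_ac)
      have "cosh (2 * \<mu> * t i) \<le> exp \<bar>2 * \<mu> * t i\<bar>"
        by (auto simp: cosh_def abs_real_def)
      with le show ?thesis by (meson exp_le_cancel_iff order_trans)
    qed
    \<comment> \<open>The tangent at \<open>s = \<mu>\<^sup>2\<close>, evaluated at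
      \<open>x = \<mu> * t i\<close>, touches where \<open>\<bar>\<theta> i\<bar> = \<tau>\<close>,
      the expected worst case.\<close>
    have lin: "(t i)\<^sup>2 - 2 * c * \<mu> * t i * sinh (\<mu> * t i) \<le>
        (1 - 2 * c * ?C) * (t i)\<^sup>2 + 2 * c * ?s * ((?s * cosh ?s - sinh ?s) / 2)" for i
    proof -
      have "?s * sinh ?s + (sinh ?s + ?s * cosh ?s) / (2 * ?s) * ((\<mu> * t i)\<^sup>2 - ?s\<^sup>2) \<le> \<mu> * t i * sinh (\<mu> * t i)"
        by (rule mult_sinh_above_tangent[OF s])
      moreover have "?s * sinh ?s + (sinh ?s + ?s * cosh ?s) / (2 * ?s) * ((\<mu> * t i)\<^sup>2 - ?s\<^sup>2) =
          ?C * (t i)\<^sup>2 - ?s * ((?s * cosh ?s - sinh ?s) / 2)"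
        using \<mu> by (simp add: field_simps power2_eq_square)
      ultimately have "2 * c * (?C * (t i)\<^sup>2 - ?s * ((?s * cosh ?s - sinh ?s) / 2)) \<le> 2 * c * (\<mu> * t i * sinh (\<mu> * t i))"
        using c by (intro mult_left_mono) auto
      then show ?thesis by (simp add: algebra_simps)
    qed
    have D: "2 * c * ?s * ((?s * cosh ?s - sinh ?s) / 2) \<ge> 0"
      using sinh_le_mult_cosh[OF s] c s by (intro mult_nonneg_nonneg) auto
    have "(\<Sum>i\<in>S. (t i)\<^sup>2 - 2 * c * \<mu> * t i * sinh (\<mu> * t i)) \<le>
        (\<Sum>i\<in>S. (1 - 2 * c * ?C) * (t i)\<^sup>2 + 2 * c * ?s * ((?s * cosh ?s - sinh ?s) / 2))"
      by (intro sum_mono lin)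
    also have "\<dots> = (1 - 2 * c * ?C) * (\<Sum>i\<in>S. (t i)\<^sup>2) + card S * (2 * c * ?s * ((?s * cosh ?s - sinh ?s) / 2))"
      by (simp add: sum.distrib sum_distrib_left)
    \<comment> \<open>Both coefficients are nonnegative, by \<open>small\<close> and
      \<open>D\<close>, so the sum of squares and the support size are raised to their maxima
      separately.\<close>
    also have "\<dots> \<le> (1 - 2 * c * ?C) * (k * \<mu>\<^sup>2) + k * (2 * c * ?s * ((?s * cosh ?s - sinh ?s) / 2))"
      using sum_t small cardS D by (intro add_mono mult_left_mono mult_right_mono) auto
    \<comment> \<open>The \<open>cosh\<close> terms cancel because the linear bound is exact at
      \<open>(t i)\<^sup>2 = \<mu>\<^sup>2\<close>.\<close>
    also have "\<dots> = k * \<mu>\<^sup>2 - 2 * c * k * \<mu>\<^sup>2 * sinh ?s"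
      by (simp add: field_simps power2_eq_square)
    finally have sig: "(\<Sum>i\<in>S. (t i)\<^sup>2 - 2 * c * \<mu> * t i * sinh (\<mu> * t i)) \<le> \<dots>" .
    have noise: "(\<Sum>i\<in>{1..n}. exp ?s * cosh (2 * \<mu> * t i) - exp (- ?s)) \<le> exp ?s * (n + k * exp (2 * A * \<mu>\<^sup>2))"
    proof -
      have "(\<Sum>i\<in>{1..n}. exp ?s * cosh (2 * \<mu> * t i) - exp (- ?s)) \<le>
          (\<Sum>i\<in>{1..n}. exp ?s * (1 + (if i \<in> S then exp (2 * A * \<mu>\<^sup>2) else 0)))"
      proof (intro sum_mono)
        fix i assume i: "i \<in> {1..n}"
        \<comment> \<open>Off the support the value is \<open>cosh 0 = 1\<close>; keeping the 1 on
          the support as well splits the sum into \<open>n\<close> and a multiple of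
          \<open>card S\<close>.\<close>
        have "cosh (2 * \<mu> * t i) \<le> 1 + (if i \<in> S then exp (2 * A * \<mu>\<^sup>2) else 0)"
          using cosh_le[of i] t0[of i] i by auto
        then have "exp ?s * cosh (2 * \<mu> * t i) \<le> exp ?s * (1 + (if i \<in> S then exp (2 * A * \<mu>\<^sup>2) else 0))"
          by (intro mult_left_mono) auto
        then show "exp ?s * cosh (2 * \<mu> * t i) - exp (- ?s) \<le> exp ?s * (1 + (if i \<in> S then exp (2 * A * \<mu>\<^sup>2) else 0))"
          using exp_gt_zero[of "- ?s"] by linarith
      qed
      also have "\<dots> = exp ?s * (n + card S * exp (2 * A * \<mu>\<^sup>2))"
        using S by (simp add: sum_distrib_left[symmetric] sum.distrib sum.inter_restrict[symmetric] Int_absorb1)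
      also have "\<dots> \<le> exp ?s * (n + k * exp (2 * A * \<mu>\<^sup>2))"
        using cardS by (intro mult_left_mono add_mono mult_right_mono) auto
      finally show ?thesis .
    qed
    have "(\<Sum>i\<in>{1..n}. (c * \<tau>)\<^sup>2 * ((exp (\<mu>\<^sup>2) * cosh (2 * \<mu> * (\<theta> i / \<sigma>)) - exp (- \<mu>\<^sup>2)) / 2)
       - 2 * (c * \<tau>) * \<theta> i * sinh (\<mu> * (\<theta> i / \<sigma>)) + (\<theta> i)\<^sup>2) =
       (\<Sum>i\<in>{1..n}. \<sigma>\<^sup>2 * (1/2 * c\<^sup>2 * \<mu>\<^sup>2 * (exp ?s * cosh (2 * \<mu> * t i) - exp (- ?s)) +
          ((t i)\<^sup>2 - 2 * c * \<mu> * t i * sinh (\<mu> * t i))))"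
      unfolding t_def[symmetric] unfolding \<theta>t \<tau>
      by (intro sum.cong refl) (simp add: field_simps power2_eq_square)
    also have "\<dots> = \<sigma>\<^sup>2 * (1/2 * c\<^sup>2 * \<mu>\<^sup>2 * (\<Sum>i\<in>{1..n}. exp ?s * cosh (2 * \<mu> * t i) - exp (- ?s)) +
        (\<Sum>i\<in>{1..n}. (t i)\<^sup>2 - 2 * c * \<mu> * t i * sinh (\<mu> * t i)))"
      by (simp only: sum_distrib_left[symmetric] sum.distrib)
    also have "(\<Sum>i\<in>{1..n}. (t i)\<^sup>2 - 2 * c * \<mu> * t i * sinh (\<mu> * t i)) =
        (\<Sum>i\<in>S. (t i)\<^sup>2 - 2 * c * \<mu> * t i * sinh (\<mu> * t i))"
      using S t0 by (intro sum.mono_neutral_right) auto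
    also have "\<sigma>\<^sup>2 * (1/2 * c\<^sup>2 * \<mu>\<^sup>2 * (\<Sum>i\<in>{1..n}. exp ?s * cosh (2 * \<mu> * t i) - exp (- ?s)) + \<dots>) \<le>
       \<sigma>\<^sup>2 * (1/2 * c\<^sup>2 * \<mu>\<^sup>2 * (exp ?s * (n + k * exp (2 * A * \<mu>\<^sup>2))) + (k * \<mu>\<^sup>2 - 2 * c * k * \<mu>\<^sup>2 * sinh ?s))"
      using sig noise by (intro mult_left_mono add_mono) auto
    also have "\<dots> = \<sigma>\<^sup>2 * (k * \<mu>\<^sup>2 - 2 * c * k * \<mu>\<^sup>2 * sinh (\<mu>\<^sup>2) +
        1/2 * c\<^sup>2 * \<mu>\<^sup>2 * exp (\<mu>\<^sup>2) * (n + k * exp (2 * A * \<mu>\<^sup>2)))"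
      by (simp add: field_simps)
    finally show ?thesis
      unfolding risk_sinh_estimator[OF \<sigma>] by (rule ennreal_leI)
  qed
  then show ?thesis
    unfolding minimax_risk_def
    by (intro INF_lower2[OF sinh_estimator_measurable] SUP_least)
qed

text \<open>The zero estimator achieves this. The bound shows that the minimax risk is finite, so
  that \<open>enn2real\<close> loses nothing.\<close>

lemma minimax_risk_sparse_le_trivial:
  "minimax_risk n (sparse_space A n k \<tau>) \<sigma> \<le> ennreal (k * \<tau>\<^sup>2)"
proof -
  interpret prob_space "std_gaussian n" by (rule prob_space_std_gaussian)
  let ?T = "\<lambda>_. \<lambda>i\<in>{1..n}. 0 :: real"
  have T: "?T \<in> estimators n" unfolding estimators_def by measurable
  have "risk n \<sigma> ?T \<theta> \<le> ennreal (k * \<tau>\<^sup>2)" if "\<theta> \<in> sparse_space A n k \<tau>" for \<theta>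
  proof -
    have "risk n \<sigma> ?T \<theta> = ennreal (\<Sum>i\<in>{1..n}. (\<theta> i)\<^sup>2)"
      unfolding risk_eq[OF T] by (simp add: emeasure_space_1)
    then show ?thesis
      using that by (auto simp: sparse_space_def intro!: ennreal_leI)
  qed
  then show ?thesis
    unfolding minimax_risk_def by (intro INF_lower2[OF T] SUP_least)
qed

section \<open>Bayes risk of a single spike in a block\<close>

text \<open>The lower bound \<open>f\<close> may be negative at some points, where
  \<open>ennreal\<close> truncates it to 0; its positive part mediates between the two
  integrals.\<close>

lemma integral_le_nn_integral:
  assumes "has_bochner_integral M f x" and "\<And>z. z \<in> space M \<Longrightarrow> ennreal (f z) \<le> F z"
  shows "ennreal x \<le> integral\<^sup>N M F"
proof -
  have f: "integrable M f" and x: "x = integral\<^sup>L M f"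
    using assms(1) by (auto simp: has_bochner_integral_iff)
  have "ennreal x \<le> ennreal (\<integral>z. max 0 (f z) \<partial>M)"
    unfolding x using f by (intro ennreal_leI integral_mono integrable_max) auto
  also have "\<dots> = (\<integral>\<^sup>+z. ennreal (max 0 (f z)) \<partial>M)"
    using f by (intro nn_integral_eq_integral[symmetric] integrable_max) auto
  also have "\<dots> \<le> integral\<^sup>N M F"
    using assms(2) by (intro nn_integral_mono) (simp add: max_def ennreal_neg split: if_splits)
  finally show ?thesis .
qed

lemma cosh_lr_ge: "exp (- \<mu>\<^sup>2 / 2) \<le> cosh_lr \<mu> x"
  unfolding cosh_lr_def using cosh_real_ge_1[of "\<mu> * x"] by simp

lemma cosh_lr_pos: "0 < cosh_lr \<mu> x"
  by (simp add: cosh_lr_def)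

text \<open>Completing the square in \<open>g\<close>: the right-hand side is the value at the posterior mean.\<close>

lemma spike_posterior_loss_ge:
  fixes g z :: "nat \<Rightarrow> real" and \<tau> \<mu> :: real
  assumes B: "finite B" "B \<noteq> {}"
  defines "C \<equiv> (\<Sum>i\<in>B. cosh_lr \<mu> (z i))"
  shows "2 * \<tau>\<^sup>2 * (C - (\<Sum>i\<in>B. (sinh_lr \<mu> (z i))\<^sup>2 / C)) \<le>
    (\<Sum>(i, s)\<in>B \<times> {-1, 1}. (\<Sum>j\<in>B. (g j - (if j = i then s * \<tau> else 0))\<^sup>2) *
       exp (s * \<mu> * z i - (s * \<mu>)\<^sup>2 / 2))"
proof -
  have C: "C > 0"
    unfolding C_def using B by (intro sum_pos cosh_lr_pos)
  define G where "G = (\<Sum>j\<in>B. (g j)\<^sup>2)"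
  \<comment> \<open>The target has \<open>i\<close> as its only possibly nonzero coordinate, so the
    squared norm of \<open>g\<close> changes by a term linear in \<open>g i\<close> and a
    constant.\<close>
  have inner: "(\<Sum>j\<in>B. (g j - (if j = i then a else 0))\<^sup>2) = G - 2 * a * g i + a\<^sup>2" if "i \<in> B" for i a
  proof -
    have "(\<Sum>j\<in>B. (g j - (if j = i then a else 0))\<^sup>2) = (\<Sum>j\<in>B. (g j)\<^sup>2 + (if j = i then a\<^sup>2 - 2 * a * g i else 0))"
      by (intro sum.cong) (auto simp: power2_diff)
    then show ?thesis using B that by (simp add: sum.distrib G_def)
  qed
  have "(\<Sum>(i, s)\<in>B \<times> {-1, 1}. (\<Sum>j\<in>B. (g j - (if j = i then s * \<tau> else 0))\<^sup>2) *
       exp (s * \<mu> * z i - (s * \<mu>)\<^sup>2 / 2)) =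
     (\<Sum>i\<in>B. (G + 2 * \<tau> * g i + \<tau>\<^sup>2) * exp (- \<mu> * z i - \<mu>\<^sup>2 / 2) + (G - 2 * \<tau> * g i + \<tau>\<^sup>2) * exp (\<mu> * z i - \<mu>\<^sup>2 / 2))"
    by (simp add: sum.cartesian_product[symmetric] inner)
  also have "\<dots> = (\<Sum>i\<in>B. 2 * ((G + \<tau>\<^sup>2) * cosh_lr \<mu> (z i) - 2 * \<tau> * g i * sinh_lr \<mu> (z i)))"
  proof (intro sum.cong refl)
    fix i
    have "exp (- \<mu> * z i - \<mu>\<^sup>2 / 2) = cosh_lr \<mu> (z i) - sinh_lr \<mu> (z i)"
         "exp (\<mu> * z i - \<mu>\<^sup>2 / 2) = cosh_lr \<mu> (z i) + sinh_lr \<mu> (z i)"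
      unfolding cosh_lr_def sinh_lr_def
      by (simp_all add: cosh_minus_sinh cosh_plus_sinh flip: right_diff_distrib distrib_left exp_add)
    then show "(G + 2 * \<tau> * g i + \<tau>\<^sup>2) * exp (- \<mu> * z i - \<mu>\<^sup>2 / 2) + (G - 2 * \<tau> * g i + \<tau>\<^sup>2) * exp (\<mu> * z i - \<mu>\<^sup>2 / 2)
      = 2 * ((G + \<tau>\<^sup>2) * cosh_lr \<mu> (z i) - 2 * \<tau> * g i * sinh_lr \<mu> (z i))"
      by (simp only:) (simp add: algebra_simps)
  qed
  also have "\<dots> = 2 * ((G + \<tau>\<^sup>2) * C - (\<Sum>i\<in>B. 2 * \<tau> * g i * sinh_lr \<mu> (z i)))"
    by (simp add: C_def sum_subtractf sum_distrib_left)
  also have "\<dots> = 2 * (\<tau>\<^sup>2 * C + (\<Sum>i\<in>B. C * (g i)\<^sup>2 - 2 * \<tau> * g i * sinh_lr \<mu> (z i)))"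
    by (simp add: G_def sum_subtractf sum_distrib_left algebra_simps)
  also have "\<dots> \<ge> 2 * (\<tau>\<^sup>2 * C + (\<Sum>i\<in>B. - (\<tau>\<^sup>2 * ((sinh_lr \<mu> (z i))\<^sup>2 / C))))"
  proof (intro mult_left_mono add_left_mono sum_mono)
    fix i
    have "C * (g i)\<^sup>2 - 2 * \<tau> * g i * sinh_lr \<mu> (z i) + \<tau>\<^sup>2 * ((sinh_lr \<mu> (z i))\<^sup>2 / C) =
        (C * g i - \<tau> * sinh_lr \<mu> (z i))\<^sup>2 / C"
      using C by (simp add: field_simps power2_eq_square)
    moreover have "\<dots> \<ge> 0" using C by simp
    ultimately show "- (\<tau>\<^sup>2 * ((sinh_lr \<mu> (z i))\<^sup>2 / C)) \<le> C * (g i)\<^sup>2 - 2 * \<tau> * g i * sinh_lr \<mu> (z i)"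
      by linarith
  qed auto
  finally show ?thesis
    by (simp add: sum_negf sum_distrib_left algebra_simps)
qed

text \<open>Expanding \<open>1 / x\<close> at 1 to second order and using the lower bound \<open>x \<ge> 1 / K\<close> in the
  remainder replaces the reciprocal by a polynomial, whose expectation is explicit.\<close>

lemma inverse_le_quadratic:
  fixes x K :: real
  assumes "x > 0" "1 / x \<le> K"
  shows "1 / x \<le> 1 - (x - 1) + K * (x - 1)\<^sup>2"
proof -
  have "1 / x = 1 - (x - 1) + 1 / x * (x - 1)\<^sup>2"
    using assms(1) by (simp add: field_simps power2_eq_square)
  also have "\<dots> \<le> 1 - (x - 1) + K * (x - 1)\<^sup>2"
    using assms(2) by (intro add_left_mono mult_right_mono) auto
  finally show ?thesis .
qed

text \<open>The quadratic of \<open>inverse_le_quadratic\<close> at the mean of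
  \<open>cosh_lr\<close> over \<open>J\<close>, divided once more by \<open>card J\<close>; the
  constant \<open>exp (\<mu>\<^sup>2 / 2)\<close> bounds the reciprocal of that mean by
  \<open>cosh_lr_ge\<close>.\<close>

definition recip_majorant :: "real \<Rightarrow> nat set \<Rightarrow> (nat \<Rightarrow> real) \<Rightarrow> real" where
  "recip_majorant \<mu> J z =
    (1 - (\<Sum>j\<in>J. cosh_lr \<mu> (z j) - 1) / card J +
      exp (\<mu>\<^sup>2 / 2) * ((\<Sum>j\<in>J. cosh_lr \<mu> (z j) - 1) / card J)\<^sup>2) / card J"

lemma inverse_sum_cosh_lr_le:
  assumes J: "finite J" "J \<noteq> {}"
  shows "1 / (\<Sum>j\<in>J. cosh_lr \<mu> (z j)) \<le> recip_majorant \<mu> J z"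
proof -
  define q where "q = real (card J)"
  have q: "q > 0" using J by (simp add: q_def card_gt_0_iff)
  define x where "x = (\<Sum>j\<in>J. cosh_lr \<mu> (z j)) / q"
  have "q * exp (- \<mu>\<^sup>2 / 2) \<le> (\<Sum>j\<in>J. cosh_lr \<mu> (z j))"
    using sum_mono[of J "\<lambda>_. exp (- \<mu>\<^sup>2 / 2)"] cosh_lr_ge by (simp add: q_def)
  then have x: "exp (- \<mu>\<^sup>2 / 2) \<le> x"
    using q by (simp add: x_def field_simps)
  then have x0: "x > 0" using exp_gt_zero order_less_le_trans by blast
  have "1 / x \<le> 1 / exp (- \<mu>\<^sup>2 / 2)" using x x0 by (intro divide_left_mono) auto
  also have "\<dots> = exp (\<mu>\<^sup>2 / 2)" by (simp add: exp_minus field_simps)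
  finally have "1 / x \<le> 1 - (x - 1) + exp (\<mu>\<^sup>2 / 2) * (x - 1)\<^sup>2"
    using x0 by (intro inverse_le_quadratic)
  then have "1 / x / q \<le> (1 - (x - 1) + exp (\<mu>\<^sup>2 / 2) * (x - 1)\<^sup>2) / q"
    using q by (intro divide_right_mono) auto
  moreover have "1 / x / q = 1 / (\<Sum>j\<in>J. cosh_lr \<mu> (z j))"
    using q by (simp add: x_def)
  moreover have "(\<Sum>j\<in>J. cosh_lr \<mu> (z j) - 1) / card J = x - 1"
    using q by (simp add: x_def sum_subtractf field_simps q_def)
  ultimately show ?thesis by (simp add: recip_majorant_def q_def)
qed

lemma has_bochner_integral_sinh_lr_sq:
  "has_bochner_integral gauss (\<lambda>x. (sinh_lr \<mu> x)\<^sup>2) (sinh (\<mu>\<^sup>2))"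
proof -
  have "(exp (\<mu>\<^sup>2) * cosh (2 * \<mu> * 0) - exp (- \<mu>\<^sup>2)) / 2 = sinh (\<mu>\<^sup>2)"
    by (simp add: sinh_def)
  then show ?thesis
    using has_bochner_integral_sinh_lr_sq_shift[of \<mu> 0] by simp
qed

text \<open>As \<open>i\<close> lies outside \<open>J\<close>, the two factors are independent. The
  centred \<open>cosh_lr\<close> terms kill the linear part and the off-diagonal products; the
  diagonal leaves \<open>card J\<close> copies of \<open>cosh (\<mu>\<^sup>2) - 1\<close> over the
  square of \<open>card J\<close>.\<close>

lemma has_bochner_integral_sinh_recip_majorant:
  assumes J: "J \<subseteq> {1..n}" "J \<noteq> {}" and i: "i \<in> {1..n}" "i \<notin> J"
  shows "has_bochner_integral (std_gaussian n) (\<lambda>z. (sinh_lr \<mu> (z i))\<^sup>2 * recip_majorant \<mu> J z)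
     (sinh (\<mu>\<^sup>2) * (1 + exp (\<mu>\<^sup>2 / 2) * (cosh (\<mu>\<^sup>2) - 1) / card J) / card J)"
proof -
  have fin: "finite J" using J(1) finite_subset by blast
  define q where "q = real (card J)"
  have q: "q > 0" using J fin by (simp add: q_def card_gt_0_iff)
  let ?K = "exp (\<mu>\<^sup>2 / 2)" and ?S = "sinh (\<mu>\<^sup>2)" and ?V = "cosh (\<mu>\<^sup>2) - 1"
  define s where "s x = (sinh_lr \<mu> x)\<^sup>2" for x
  define d where "d x = cosh_lr \<mu> x - 1" for x
  have hs: "has_bochner_integral gauss s ?S"
    using has_bochner_integral_sinh_lr_sq by (simp add: s_def[abs_def])
  have hd: "has_bochner_integral gauss d 0"
    using has_bochner_integral_diff[OF has_bochner_integral_cosh_lr has_bochner_integral_gauss_const[of 1]]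
    by (simp add: d_def[abs_def])
  have hd2: "has_bochner_integral gauss (\<lambda>x. d x * d x) ?V"
    using has_bochner_integral_cosh_lr_sq by (simp add: d_def power2_eq_square)
  have h0: "has_bochner_integral (std_gaussian n) (\<lambda>z. s (z i)) ?S"
    using has_bochner_integral_std_gaussian_prod[of "{i}" n "\<lambda>_. s" "\<lambda>_. ?S"] hs i by simp
  have h1: "has_bochner_integral (std_gaussian n) (\<lambda>z. s (z i) * d (z j)) 0" if j: "j \<in> J" for j
  proof -
    have "i \<noteq> j" "j \<in> {1..n}" using j i J by auto
    then show ?thesis
      using has_bochner_integral_std_gaussian_prod[of "{i, j}" n "\<lambda>t. if t = i then s else d" "\<lambda>t. if t = i then ?S else 0"]
        hs hd i by auto
  qed
  have h2: "has_bochner_integral (std_gaussian n) (\<lambda>z. s (z i) * (d (z j) * d (z l))) (if j = l then ?S * ?V else 0)"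
    if j: "j \<in> J" and l: "l \<in> J" for j l
  proof -
    have ne: "i \<noteq> j" "j \<in> {1..n}" "i \<noteq> l" "l \<in> {1..n}" using j l i J by auto
    show ?thesis
    proof (cases "j = l")
      case True
      then show ?thesis
        using has_bochner_integral_std_gaussian_prod[of "{i, j}" n "\<lambda>t. if t = i then s else (\<lambda>x. d x * d x)" "\<lambda>t. if t = i then ?S else ?V"]
          hs hd2 i ne by auto
    next
      case False
      then show ?thesis
        using has_bochner_integral_std_gaussian_prod[of "{i, j, l}" n "\<lambda>t. if t = i then s else d" "\<lambda>t. if t = i then ?S else 0"]
          hs hd i ne by auto
    qed
  qed
  have H1: "has_bochner_integral (std_gaussian n) (\<lambda>z. \<Sum>j\<in>J. s (z i) * d (z j)) (\<Sum>j\<in>J. 0)"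
    by (intro has_bochner_integral_sum h1)
  have H2: "has_bochner_integral (std_gaussian n) (\<lambda>z. \<Sum>j\<in>J. \<Sum>l\<in>J. s (z i) * (d (z j) * d (z l)))
     (\<Sum>j\<in>J. \<Sum>l\<in>J. if j = l then ?S * ?V else 0)"
    by (intro has_bochner_integral_sum h2)
  have "has_bochner_integral (std_gaussian n)
     (\<lambda>z. (s (z i) - (\<Sum>j\<in>J. s (z i) * d (z j)) / q + ?K * (\<Sum>j\<in>J. \<Sum>l\<in>J. s (z i) * (d (z j) * d (z l))) / q\<^sup>2) / q)
     ((?S - (\<Sum>j\<in>J. 0) / q + ?K * (\<Sum>j\<in>J. \<Sum>l\<in>J. if j = l then ?S * ?V else 0) / q\<^sup>2) / q)"
    by (intro has_bochner_integral_add has_bochner_integral_diff has_bochner_integral_divide_zero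
        has_bochner_integral_mult_right h0 H1 H2)
  moreover have "(s (z i) - (\<Sum>j\<in>J. s (z i) * d (z j)) / q + ?K * (\<Sum>j\<in>J. \<Sum>l\<in>J. s (z i) * (d (z j) * d (z l))) / q\<^sup>2) / q
     = (sinh_lr \<mu> (z i))\<^sup>2 * recip_majorant \<mu> J z" for z
    unfolding recip_majorant_def power_divide power2_eq_square[of "sum _ _"]
      sum_product q_def[symmetric] s_def[symmetric] d_def[symmetric] sum_distrib_left[symmetric]
    by (simp add: algebra_simps add_divide_distrib diff_divide_distrib)
  moreover have "(?S - (\<Sum>j\<in>J. 0) / q + ?K * (\<Sum>j\<in>J. \<Sum>l\<in>J. if j = l then ?S * ?V else 0) / q\<^sup>2) / q
     = ?S * (1 + ?K * ?V / card J) / card J"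
    using q fin by (simp add: q_def[symmetric] power2_eq_square field_simps)
  ultimately show ?thesis by (simp only:)
qed

text \<open>Upper bound for the fraction of \<open>\<tau>\<^sup>2\<close> that an estimator can save
  on average in a block of \<open>q + 1\<close> coordinates holding one spike; the leading term is
  \<open>sinh (\<mu>\<^sup>2) / q\<close>.\<close>

definition spike_gain :: "real \<Rightarrow> nat \<Rightarrow> real" where
  "spike_gain \<mu> q = sinh (\<mu>\<^sup>2) * (1 + exp (\<mu>\<^sup>2 / 2) * (cosh (\<mu>\<^sup>2) - 1) / q) / q"

text \<open>Up to the factor \<open>2 * m\<close>, the right-hand side is the average risk of
  \<open>g\<close> under a uniform position and sign of the spike. The posterior bound is integrated
  once its denominator is independent of the numerator; this costs one coordinate, hence
  \<open>m - 1\<close>.\<close>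

lemma spike_block_lower_bound:
  fixes g :: "nat \<Rightarrow> (nat \<Rightarrow> real) \<Rightarrow> real"
  assumes B: "B \<subseteq> {1..n}" and m: "card B = m" "m \<ge> 2"
    and g[measurable]: "\<And>j. j \<in> B \<Longrightarrow> g j \<in> borel_measurable (std_gaussian n)"
  shows "ennreal (2 * m * \<tau>\<^sup>2 * (1 - spike_gain \<mu> (m - 1))) \<le>
    (\<Sum>(i, s)\<in>B \<times> {-1, 1}. \<integral>\<^sup>+z. ennreal (\<Sum>j\<in>B. (g j z - (if j = i then s * \<tau> else 0))\<^sup>2) *
       ennreal (exp (s * \<mu> * z i - (s * \<mu>)\<^sup>2 / 2)) \<partial>std_gaussian n)"
proof -
  have fin: "finite B" and ne: "B \<noteq> {}" using B m finite_subset by auto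
  have minus: "card (B - {i}) = m - 1" "B - {i} \<noteq> {}" "B - {i} \<subseteq> {1..n}" if "i \<in> B" for i
  proof -
    show c: "card (B - {i}) = m - 1" using that fin m by simp
    show "B - {i} \<noteq> {}" using c m card_gt_0_iff[of "B - {i}"] by linarith
    show "B - {i} \<subseteq> {1..n}" using B by auto
  qed
  define G where "G z = 2 * \<tau>\<^sup>2 * ((\<Sum>i\<in>B. cosh_lr \<mu> (z i)) -
      (\<Sum>i\<in>B. (sinh_lr \<mu> (z i))\<^sup>2 * recip_majorant \<mu> (B - {i}) z))" for z
  have hc: "has_bochner_integral (std_gaussian n) (\<lambda>z. cosh_lr \<mu> (z i)) 1" if "i \<in> B" for i
    using has_bochner_integral_std_gaussian_prod[of "{i}" n "\<lambda>_. cosh_lr \<mu>" "\<lambda>_. 1"]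
      has_bochner_integral_cosh_lr that B by auto
  have hr: "has_bochner_integral (std_gaussian n) (\<lambda>z. (sinh_lr \<mu> (z i))\<^sup>2 * recip_majorant \<mu> (B - {i}) z)
      (spike_gain \<mu> (m - 1))" if "i \<in> B" for i
    using has_bochner_integral_sinh_recip_majorant[of "B - {i}" n i \<mu>] minus[OF that] that B
    by (auto simp: spike_gain_def)
  have "has_bochner_integral (std_gaussian n) G (2 * \<tau>\<^sup>2 * ((\<Sum>i\<in>B. 1) - (\<Sum>i\<in>B. spike_gain \<mu> (m - 1))))"
    unfolding G_def[abs_def]
    by (intro has_bochner_integral_mult_right has_bochner_integral_diff has_bochner_integral_sum hc hr)
  moreover have "2 * \<tau>\<^sup>2 * ((\<Sum>i\<in>B. 1) - (\<Sum>i\<in>B. spike_gain \<mu> (m - 1))) = 2 * m * \<tau>\<^sup>2 * (1 - spike_gain \<mu> (m - 1))"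
    using m by (simp add: algebra_simps)
  ultimately have hG: "has_bochner_integral (std_gaussian n) G (2 * m * \<tau>\<^sup>2 * (1 - spike_gain \<mu> (m - 1)))"
    by (simp only:)
  let ?F = "\<lambda>z. \<Sum>(i, s)\<in>B \<times> {-1, 1}. ennreal (\<Sum>j\<in>B. (g j z - (if j = i then s * \<tau> else 0))\<^sup>2) *
       ennreal (exp (s * \<mu> * z i - (s * \<mu>)\<^sup>2 / 2))"
  have "ennreal (2 * m * \<tau>\<^sup>2 * (1 - spike_gain \<mu> (m - 1))) \<le> (\<integral>\<^sup>+z. ?F z \<partial>std_gaussian n)"
  proof (rule integral_le_nn_integral[OF hG])
    fix z :: "nat \<Rightarrow> real"
    define C where "C = (\<Sum>i\<in>B. cosh_lr \<mu> (z i))"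
    have "G z \<le> 2 * \<tau>\<^sup>2 * (C - (\<Sum>i\<in>B. (sinh_lr \<mu> (z i))\<^sup>2 / C))"
      unfolding G_def C_def[symmetric]
    proof (intro mult_left_mono diff_left_mono sum_mono)
      fix i assume i: "i \<in> B"
      \<comment> \<open>Dropping term \<open>i\<close> from the denominator can only enlarge the
        quotient, and makes the denominator independent of \<open>sinh_lr \<mu> (z i)\<close>;
        \<open>m \<ge> 2\<close> keeps the remaining sum positive.\<close>
      let ?M = "\<Sum>j\<in>B-{i}. cosh_lr \<mu> (z j)"
      have "C = cosh_lr \<mu> (z i) + ?M" unfolding C_def using fin i by (simp add: sum.remove)
      moreover have "?M > 0"
        using fin minus[OF i] by (intro sum_pos cosh_lr_pos) auto
      ultimately have "1 / C \<le> 1 / ?M"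
        using cosh_lr_pos[of \<mu> "z i"] by (intro divide_left_mono) auto
      also have "\<dots> \<le> recip_majorant \<mu> (B - {i}) z"
        using fin minus[OF i] by (intro inverse_sum_cosh_lr_le) auto
      finally have "1 / C \<le> recip_majorant \<mu> (B - {i}) z" .
      from mult_left_mono[OF this, of "(sinh_lr \<mu> (z i))\<^sup>2"]
      show "(sinh_lr \<mu> (z i))\<^sup>2 / C \<le> (sinh_lr \<mu> (z i))\<^sup>2 * recip_majorant \<mu> (B - {i}) z"
        by simp
    qed auto
    also have "\<dots> \<le> (\<Sum>(i, s)\<in>B \<times> {-1, 1}. (\<Sum>j\<in>B. (g j z - (if j = i then s * \<tau> else 0))\<^sup>2) *
       exp (s * \<mu> * z i - (s * \<mu>)\<^sup>2 / 2))"
      unfolding C_def by (rule spike_posterior_loss_ge[OF fin ne])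
    finally have "ennreal (G z) \<le> ennreal \<dots>" by (rule ennreal_leI)
    also have "\<dots> = ?F z"
      by (subst sum_ennreal[symmetric])
        (auto simp: ennreal_mult case_prod_unfold sum_nonneg intro!: mult_nonneg_nonneg sum.cong)
    finally show "ennreal (G z) \<le> ?F z" .
  qed
  also have "\<dots> = (\<Sum>p\<in>B \<times> {-1, 1}. \<integral>\<^sup>+z. (case p of (i, s) \<Rightarrow> ennreal (\<Sum>j\<in>B. (g j z - (if j = i then s * \<tau> else 0))\<^sup>2) *
       ennreal (exp (s * \<mu> * z i - (s * \<mu>)\<^sup>2 / 2))) \<partial>std_gaussian n)"
  proof (intro nn_integral_sum)
    fix p assume p: "p \<in> B \<times> {-1, 1 :: real}"
    then have [measurable]: "(\<lambda>z. z (fst p)) \<in> borel_measurable (std_gaussian n)"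
      using B by (auto simp: measurable_cong_sets[OF sets_std_gaussian refl])
    show "(\<lambda>z. case p of (i, s) \<Rightarrow> ennreal (\<Sum>j\<in>B. (g j z - (if j = i then s * \<tau> else 0))\<^sup>2) *
       ennreal (exp (s * \<mu> * z i - (s * \<mu>)\<^sup>2 / 2))) \<in> borel_measurable (std_gaussian n)"
      unfolding case_prod_unfold by measurable
  qed
  finally show ?thesis by (simp add: case_prod_unfold)
qed

section \<open>Independent spikes in disjoint blocks\<close>

text \<open>The share of the risk that falls on \<open>B\<close>, as an integral over the noise so
  that a change of \<theta> becomes a shift of \<open>z\<close>.\<close>

definition block_risk ::
    "nat \<Rightarrow> nat set \<Rightarrow> real \<Rightarrow> ((nat \<Rightarrow> real) \<Rightarrow> nat \<Rightarrow> real) \<Rightarrow> (nat \<Rightarrow> real) \<Rightarrow> ennreal" where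
  "block_risk n B \<sigma> T \<theta> =
    (\<integral>\<^sup>+z. ennreal (\<Sum>j\<in>B. (T (\<lambda>i\<in>{1..n}. \<theta> i + \<sigma> * z i) j - \<theta> j)\<^sup>2) \<partial>std_gaussian n)"

lemma estimator_component_measurable:
  assumes "T \<in> estimators n" "j \<in> {1..n}"
  shows "(\<lambda>z. T (\<lambda>i\<in>{1..n}. \<theta> i + \<sigma> * z i) j) \<in> borel_measurable (std_gaussian n)"
proof -
  have T: "(\<lambda>y. T y j) \<in> borel_measurable (PiM {1..n} (\<lambda>_. borel))"
    using assms unfolding estimators_def by measurable
  have aff: "(\<lambda>z. \<lambda>i\<in>{1..n}. \<theta> i + \<sigma> * z i) \<in> std_gaussian n \<rightarrow>\<^sub>M PiM {1..n} (\<lambda>_. borel)"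
    by measurable
  from measurable_compose[OF aff T] show ?thesis .
qed

lemma risk_ge_sum_block_risk:
  assumes T: "T \<in> estimators n" and K: "finite K"
    and B: "disjoint_family_on B K" "\<And>b. b \<in> K \<Longrightarrow> B b \<subseteq> {1..n}"
  shows "(\<Sum>b\<in>K. block_risk n (B b) \<sigma> T \<theta>) \<le> risk n \<sigma> T \<theta>"
proof -
  let ?f = "\<lambda>z j. (T (\<lambda>i\<in>{1..n}. \<theta> i + \<sigma> * z i) j - \<theta> j)\<^sup>2"
  have finB: "finite (B b)" if "b \<in> K" for b
    using B(2)[OF that] finite_subset by blast
  have meas: "(\<lambda>z. ennreal (\<Sum>j\<in>B b. ?f z j)) \<in> borel_measurable (std_gaussian n)" if "b \<in> K" for b
  proof -
    have [measurable]: "(\<lambda>z. T (\<lambda>i\<in>{1..n}. \<theta> i + \<sigma> * z i) j) \<in> borel_measurable (std_gaussian n)" if "j \<in> B b" for j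
      using estimator_component_measurable[OF T] B(2)[OF \<open>b \<in> K\<close>] that by auto
    show ?thesis by measurable
  qed
  have "(\<Sum>b\<in>K. block_risk n (B b) \<sigma> T \<theta>) = (\<integral>\<^sup>+z. (\<Sum>b\<in>K. ennreal (\<Sum>j\<in>B b. ?f z j)) \<partial>std_gaussian n)"
    unfolding block_risk_def using meas by (intro nn_integral_sum[symmetric])
  also have "\<dots> \<le> (\<integral>\<^sup>+z. ennreal (\<Sum>j\<in>{1..n}. ?f z j) \<partial>std_gaussian n)"
  proof (intro nn_integral_mono)
    fix z :: "nat \<Rightarrow> real"
    have "(\<Sum>b\<in>K. \<Sum>j\<in>B b. ?f z j) = (\<Sum>j\<in>(\<Union>b\<in>K. B b). ?f z j)"
      using K finB B(1) by (intro sum.UNION_disjoint[symmetric]) (auto simp: disjoint_family_on_def)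
    also have "\<dots> \<le> (\<Sum>j\<in>{1..n}. ?f z j)"
      using B(2) by (intro sum_mono2) auto
    finally show "(\<Sum>b\<in>K. ennreal (\<Sum>j\<in>B b. ?f z j)) \<le> ennreal (\<Sum>j\<in>{1..n}. ?f z j)"
      by (subst sum_ennreal) (auto intro!: ennreal_leI sum_nonneg)
  qed
  finally show ?thesis unfolding risk_eq[OF T] .
qed

text \<open>A spike at \<open>i\<close> shifts the noise coordinate \<open>z i\<close> by
  \<open>s * \<mu>\<close>, and the shift is traded for a likelihood weight, so the estimator sees
  the same observation for every spike. Outside \<open>B\<close> the vector \<theta> is arbitrary,
  which lets the spikes of other blocks be held fixed.\<close>

lemma block_risk_spike_lower_bound:
  assumes T: "T \<in> estimators n" and B: "B \<subseteq> {1..n}" and m: "card B = m" "m \<ge> 2"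
    and \<sigma>: "\<sigma> > 0" and \<tau>: "\<tau> = \<mu> * \<sigma>" and \<theta>: "\<And>j. j \<in> B \<Longrightarrow> \<theta> j = 0"
  shows "ennreal (2 * m * \<tau>\<^sup>2 * (1 - spike_gain \<mu> (m - 1))) \<le>
    (\<Sum>(i, s)\<in>B \<times> {-1, 1}. block_risk n B \<sigma> T (\<theta>(i := s * \<tau>)))"
proof -
  let ?y = "\<lambda>z. \<lambda>i\<in>{1..n}. \<theta> i + \<sigma> * z i"
  have meas: "(\<lambda>z. T (?y z) j) \<in> borel_measurable (std_gaussian n)" if "j \<in> B" for j
    using estimator_component_measurable[OF T] that B by auto
  note [measurable] = meas
  have loss_meas: "(\<lambda>z. ennreal (\<Sum>j\<in>B. (T (?y z) j - (if j = i then s * \<tau> else 0))\<^sup>2))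
      \<in> borel_measurable (std_gaussian n)" for i s
    by measurable
  have shift: "block_risk n B \<sigma> T (\<theta>(i := s * \<tau>)) =
      (\<integral>\<^sup>+z. ennreal (\<Sum>j\<in>B. (T (?y z) j - (if j = i then s * \<tau> else 0))\<^sup>2) *
       ennreal (exp (s * \<mu> * z i - (s * \<mu>)\<^sup>2 / 2)) \<partial>std_gaussian n)" if i: "i \<in> B" for i s
  proof -
    have eq: "(\<lambda>j\<in>{1..n}. (\<theta>(i := s * \<tau>)) j + \<sigma> * z j) = ?y (z(i := z i + s * \<mu>))" for z
      using \<theta>[OF i] by (auto simp: fun_eq_iff \<tau> algebra_simps)
    have "(\<Sum>j\<in>B. (T y j - (\<theta>(i := s * \<tau>)) j)\<^sup>2) = (\<Sum>j\<in>B. (T y j - (if j = i then s * \<tau> else 0))\<^sup>2)" for y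
      using \<theta> by (intro sum.cong) auto
    then have "block_risk n B \<sigma> T (\<theta>(i := s * \<tau>)) =
       (\<integral>\<^sup>+z. ennreal (\<Sum>j\<in>B. (T (?y (z(i := z i + s * \<mu>))) j - (if j = i then s * \<tau> else 0))\<^sup>2) \<partial>std_gaussian n)"
      unfolding block_risk_def eq by simp
    also have "\<dots> = (\<integral>\<^sup>+z. ennreal (\<Sum>j\<in>B. (T (?y z) j - (if j = i then s * \<tau> else 0))\<^sup>2) *
       ennreal (exp (s * \<mu> * z i - (s * \<mu>)\<^sup>2 / 2)) \<partial>std_gaussian n)"
      using i B by (intro nn_integral_std_gaussian_shift loss_meas) auto
    finally show ?thesis .
  qed
  have "(\<Sum>(i, s)\<in>B \<times> {-1, 1}. block_risk n B \<sigma> T (\<theta>(i := s * \<tau>))) =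
    (\<Sum>(i, s)\<in>B \<times> {-1, 1}. \<integral>\<^sup>+z. ennreal (\<Sum>j\<in>B. (T (?y z) j - (if j = i then s * \<tau> else 0))\<^sup>2) *
       ennreal (exp (s * \<mu> * z i - (s * \<mu>)\<^sup>2 / 2)) \<partial>std_gaussian n)"
    by (intro sum.cong refl) (clarsimp simp only: mem_Sigma_iff prod.case shift)
  then show ?thesis
    using spike_block_lower_bound[OF B m, where g = "\<lambda>j z. T (?y z) j" and \<tau> = \<tau> and \<mu> = \<mu>, OF meas]
    by (simp only:)
qed

text \<open>\<open>\<phi> b\<close> is the position and sign of the spike of block \<open>b\<close>.
  With positions in disjoint blocks, at most one summand is nonzero at each coordinate, and removing
  a block just removes a summand.\<close>

definition spikes :: "nat \<Rightarrow> real \<Rightarrow> nat set \<Rightarrow> (nat \<Rightarrow> nat \<times> real) \<Rightarrow> nat \<Rightarrow> real" where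
  "spikes n \<tau> K \<phi> = (\<lambda>j\<in>{1..n}. \<Sum>b\<in>K. if j = fst (\<phi> b) then snd (\<phi> b) * \<tau> else 0)"

lemma spikes_eq_0:
  assumes "disjoint_family_on B K" "b \<in> K" "j \<in> B b"
    and "\<phi> \<in> (\<Pi>\<^sub>E b\<in>K - {b}. B b \<times> {-1, 1})" "j \<in> {1..n}"
  shows "spikes n \<tau> (K - {b}) \<phi> j = 0"
proof -
  have "j \<noteq> fst (\<phi> b')" if "b' \<in> K - {b}" for b'
  proof -
    have "fst (\<phi> b') \<in> B b'" using assms(4) that by (auto simp: PiE_iff mem_Times_iff)
    moreover have "B b \<inter> B b' = {}" using assms(1,2) that by (auto simp: disjoint_family_on_def)
    ultimately show ?thesis using assms(3) by auto
  qed
  then show ?thesis using assms(5) by (simp add: spikes_def)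
qed

text \<open>Exposes the choice made in block \<open>b\<close> as a single coordinate update with all
  other spikes fixed, the form that \<open>block_risk_spike_lower_bound\<close> takes.\<close>

lemma spikes_update:
  assumes "disjoint_family_on B K" "b \<in> K" "finite K" "B b \<subseteq> {1..n}"
    and \<phi>: "\<phi> \<in> (\<Pi>\<^sub>E b\<in>K - {b}. B b \<times> {-1, 1})" and i: "i \<in> B b"
  shows "spikes n \<tau> K (\<phi>(b := (i, s))) = (spikes n \<tau> (K - {b}) \<phi>)(i := s * \<tau>)"
proof
  fix j
  have rest: "(\<Sum>b'\<in>K - {b}. if j = fst ((\<phi>(b := (i, s))) b') then snd ((\<phi>(b := (i, s))) b') * \<tau> else 0) =
      (\<Sum>b'\<in>K - {b}. if j = fst (\<phi> b') then snd (\<phi> b') * \<tau> else 0)"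
    by (intro sum.cong) auto
  have i': "i \<in> {1..n}" using i \<open>B b \<subseteq> {1..n}\<close> by blast
  have at_i: "spikes n \<tau> (K - {b}) \<phi> i = 0" by (rule spikes_eq_0[OF assms(1,2) i \<phi> i'])
  show "spikes n \<tau> K (\<phi>(b := (i, s))) j = ((spikes n \<tau> (K - {b}) \<phi>)(i := s * \<tau>)) j"
  proof (cases "j \<in> {1..n}")
    case True
    have "spikes n \<tau> K (\<phi>(b := (i, s))) j = (if j = i then s * \<tau> else 0) + spikes n \<tau> (K - {b}) \<phi> j"
      using True assms(2,3) rest by (simp add: spikes_def sum.remove[of K b])
    then show ?thesis using at_i by auto
  next
    case False
    then show ?thesis using i' by (auto simp: spikes_def)
  qed
qed

lemma spikes_in_sparse_space:
  assumes B: "disjoint_family_on B K" "\<And>b. b \<in> K \<Longrightarrow> B b \<subseteq> {1..n}" and K: "finite K" "card K = k"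
    and \<phi>: "\<phi> \<in> (\<Pi>\<^sub>E b\<in>K. B b \<times> {-1, 1})" and \<tau>: "\<tau> > 0" and A: "A \<ge> 1" and n: "n \<ge> 1"
  shows "spikes n \<tau> K \<phi> \<in> sparse_space A n k \<tau>"
proof -
  define S where "S = (\<lambda>b. fst (\<phi> b)) ` K"
  have zero: "spikes n \<tau> K \<phi> j = 0" if "j \<notin> S" "j \<in> {1..n}" for j
    using that by (auto simp: spikes_def S_def intro!: sum.neutral)
  have val: "\<bar>spikes n \<tau> K \<phi> j\<bar> = \<tau>" if j: "j \<in> S" "j \<in> {1..n}" for j
  proof -
    obtain b where b: "b \<in> K" "j = fst (\<phi> b)" using j by (auto simp: S_def)
    have \<phi>b: "\<phi> b = (j, snd (\<phi> b))" "j \<in> B b" "snd (\<phi> b) \<in> {-1, 1}"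
      using \<phi> b by (auto simp: PiE_iff mem_Times_iff)
    \<comment> \<open>Resetting \<open>\<phi>\<close> at \<open>b\<close> makes it extensional on
      \<open>K - {b}\<close>, and updating it back restores \<open>\<phi>\<close>, so
      \<open>spikes_update\<close> reads off the value at \<open>j\<close>.\<close>
    have "\<phi>(b := undefined) \<in> (\<Pi>\<^sub>E b\<in>K - {b}. B b \<times> {-1, 1})"
      using \<phi> by (auto simp: PiE_iff extensional_def)
    from spikes_update[OF B(1) b(1) K(1) B(2)[OF b(1)] this \<phi>b(2), of \<tau> "snd (\<phi> b)"]
    have "spikes n \<tau> K \<phi> j = snd (\<phi> b) * \<tau>"
      using \<phi>b(1) by (simp flip: \<phi>b(1))
    then show ?thesis using \<phi>b(3) \<tau> by auto
  qed
  have cardS: "card S \<le> k"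
    unfolding S_def using K card_image_le by blast
  have S: "finite S" using K by (simp add: S_def)
  have "l0_norm n (spikes n \<tau> K \<phi>) \<le> card S"
    unfolding l0_norm_def using zero S by (intro card_mono) auto
  moreover have "(\<Sum>i\<in>{1..n}. (spikes n \<tau> K \<phi> i)\<^sup>2) \<le> k * \<tau>\<^sup>2"
  proof -
    have "(\<Sum>i\<in>{1..n}. (spikes n \<tau> K \<phi> i)\<^sup>2) = (\<Sum>i\<in>{1..n} \<inter> S. (spikes n \<tau> K \<phi> i)\<^sup>2)"
      using zero by (intro sum.mono_neutral_right) auto
    also have "\<dots> = (\<Sum>i\<in>{1..n} \<inter> S. \<tau>\<^sup>2)"
      using val by (intro sum.cong) (auto simp flip: power2_abs[of "spikes n \<tau> K \<phi> _"])
    also have "\<dots> \<le> k * \<tau>\<^sup>2"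
      using card_mono[OF S, of "{1..n} \<inter> S"] cardS by (auto intro!: mult_right_mono)
    finally show ?thesis .
  qed
  moreover have "sup_norm n (spikes n \<tau> K \<phi>) \<le> A * \<tau>"
  proof -
    have "\<tau> \<le> A * \<tau>" using A \<tau> by simp
    then have "\<bar>spikes n \<tau> K \<phi> j\<bar> \<le> A * \<tau>" if "j \<in> {1..n}" for j
      using zero[of j] val[of j] that \<tau> by (cases "j \<in> S") auto
    then show ?thesis unfolding sup_norm_def using n by (subst Max_le_iff) auto
  qed
  moreover have "spikes n \<tau> K \<phi> \<in> {1..n} \<rightarrow>\<^sub>E UNIV" by (simp add: spikes_def)
  ultimately show ?thesis using cardS by (simp add: sparse_space_def)
qed

lemma sum_PiE_remove:
  fixes F :: "('a \<Rightarrow> 'b) \<Rightarrow> 'c :: comm_monoid_add"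
  assumes "b \<in> K"
  shows "(\<Sum>\<phi>\<in>PiE K S. F \<phi>) = (\<Sum>\<psi>\<in>PiE (K - {b}) S. \<Sum>p\<in>S b. F (\<psi>(b := p)))"
proof -
  have ins: "insert b (K - {b}) = K" using assms by auto
  have "(\<Sum>\<phi>\<in>PiE K S. F \<phi>) = (\<Sum>x\<in>S b \<times> PiE (K - {b}) S. F ((snd x)(b := fst x)))"
    using sum.reindex[OF inj_combinator[of b "K - {b}" S], of F]
    unfolding PiE_insert_eq[symmetric] ins by (simp add: case_prod_unfold o_def)
  also have "\<dots> = (\<Sum>p\<in>S b. \<Sum>\<psi>\<in>PiE (K - {b}) S. F (\<psi>(b := p)))"
    by (simp add: sum.cartesian_product case_prod_unfold)
  also have "\<dots> = (\<Sum>\<psi>\<in>PiE (K - {b}) S. \<Sum>p\<in>S b. F (\<psi>(b := p)))"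
    by (rule sum.swap)
  finally show ?thesis .
qed

text \<open>The maximal risk is at least the average over all \<open>(2 * m) ^ k\<close> spike
  configurations. For each block, the one-block bound holds for every choice of the other spikes.
  Everything is kept multiplied by the number of configurations, which is cancelled at the
  end.\<close>

lemma minimax_risk_sparse_ge_blocks:
  fixes K :: "nat set"
  assumes B: "disjoint_family_on B K" "\<And>b. b \<in> K \<Longrightarrow> B b \<subseteq> {1..n}"
    and m: "\<And>b. b \<in> K \<Longrightarrow> card (B b) = m" "m \<ge> 2" and K: "finite K" "card K = k"
    and n: "n \<ge> 1" and \<sigma>: "\<sigma> > 0" and \<mu>: "\<mu> > 0" and \<tau>: "\<tau> = \<mu> * \<sigma>" and A: "A \<ge> 1"
  shows "ennreal (k * \<tau>\<^sup>2 * (1 - spike_gain \<mu> (m - 1))) \<le> minimax_risk n (sparse_space A n k \<tau>) \<sigma>"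
  unfolding minimax_risk_def
proof (intro INF_greatest)
  fix T assume T: "T \<in> estimators n"
  let ?v = "\<tau>\<^sup>2 * (1 - spike_gain \<mu> (m - 1))"
  let ?S = "\<lambda>b. B b \<times> {-1, 1 :: real}"
  let ?\<Phi> = "PiE K ?S"
  let ?R = "SUP \<theta>\<in>sparse_space A n k \<tau>. risk n \<sigma> T \<theta>"
  have finB: "finite (B b)" if "b \<in> K" for b using B(2)[OF that] finite_subset by blast
  have card_S: "card (?S b) = 2 * m" if "b \<in> K" for b
    using m(1)[OF that] by (simp add: card_cartesian_product)
  have card\<Phi>: "card (PiE J ?S) = (2 * m) ^ card J" if "J \<subseteq> K" for J
    using that K card_S finite_subset[OF that] by (subst card_PiE) (auto intro!: prod.cong simp: subset_iff)
  have block: "ennreal (real (card ?\<Phi>)) * ennreal ?v \<le> (\<Sum>\<phi>\<in>?\<Phi>. block_risk n (B b) \<sigma> T (spikes n \<tau> K \<phi>))"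
    if b: "b \<in> K" for b
  proof -
    \<comment> \<open>Block \<open>b\<close> contributes the factor \<open>2 * m\<close>, which is
      the normalization of the one-block bound.\<close>
    have "card ?\<Phi> = card (PiE (K - {b}) ?S) * (2 * m)"
      using card\<Phi>[of K] card\<Phi>[of "K - {b}"] card_Suc_Diff1[OF K(1) b, symmetric]
      by (simp add: mult_ac)
    then have "real (card ?\<Phi>) * ?v = real (card (PiE (K - {b}) ?S)) * (2 * m * ?v)"
      by (simp only: of_nat_mult of_nat_numeral mult_ac)
    then have "ennreal (real (card ?\<Phi>)) * ennreal ?v = of_nat (card (PiE (K - {b}) ?S)) * ennreal (2 * m * ?v)"
      by (simp only: ennreal_mult'[symmetric] of_nat_0_le_iff ennreal_of_nat_eq_real_of_nat)
    also have "\<dots> = (\<Sum>\<psi>\<in>PiE (K - {b}) ?S. ennreal (2 * m * ?v))"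
      by simp
    also have "\<dots> \<le> (\<Sum>\<psi>\<in>PiE (K - {b}) ?S. \<Sum>p\<in>?S b. block_risk n (B b) \<sigma> T (spikes n \<tau> K (\<psi>(b := p))))"
    proof (intro sum_mono)
      fix \<psi> assume \<psi>: "\<psi> \<in> PiE (K - {b}) ?S"
      have "ennreal (2 * m * ?v) \<le>
         (\<Sum>(i, s)\<in>?S b. block_risk n (B b) \<sigma> T ((spikes n \<tau> (K - {b}) \<psi>)(i := s * \<tau>)))"
        using block_risk_spike_lower_bound[OF T B(2)[OF b] m(1)[OF b] m(2) \<sigma> \<tau>, of "spikes n \<tau> (K - {b}) \<psi>"]
          spikes_eq_0[OF B(1) b _ \<psi>] B(2)[OF b] by (simp add: subset_iff mult.assoc)
      also have "\<dots> = (\<Sum>p\<in>?S b. block_risk n (B b) \<sigma> T (spikes n \<tau> K (\<psi>(b := p))))"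
        using spikes_update[OF B(1) b K(1) B(2)[OF b] \<psi>] by (intro sum.cong refl) auto
      finally show "ennreal (2 * m * ?v) \<le> \<dots>" .
    qed
    also have "\<dots> = (\<Sum>\<phi>\<in>?\<Phi>. block_risk n (B b) \<sigma> T (spikes n \<tau> K \<phi>))"
      by (rule sum_PiE_remove[OF b, symmetric])
    finally show ?thesis .
  qed
  have pos: "card ?\<Phi> > 0" using card\<Phi>[of K] m(2) by simp
  have "ennreal (real (card ?\<Phi>)) * ennreal (k * \<tau>\<^sup>2 * (1 - spike_gain \<mu> (m - 1))) =
     (\<Sum>b\<in>K. ennreal (real (card ?\<Phi>)) * ennreal ?v)"
    using K by (simp add: ennreal_mult' ennreal_of_nat_eq_real_of_nat mult_ac)
  also have "\<dots> \<le> (\<Sum>b\<in>K. \<Sum>\<phi>\<in>?\<Phi>. block_risk n (B b) \<sigma> T (spikes n \<tau> K \<phi>))"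
    by (intro sum_mono block)
  also have "\<dots> = (\<Sum>\<phi>\<in>?\<Phi>. \<Sum>b\<in>K. block_risk n (B b) \<sigma> T (spikes n \<tau> K \<phi>))"
    by (rule sum.swap)
  also have "\<dots> \<le> (\<Sum>\<phi>\<in>?\<Phi>. ?R)"
  proof (intro sum_mono)
    fix \<phi> assume \<phi>: "\<phi> \<in> ?\<Phi>"
    have "spikes n \<tau> K \<phi> \<in> sparse_space A n k \<tau>"
      using spikes_in_sparse_space[OF B K \<phi> _ A n, of \<tau>] \<sigma> \<mu> \<tau> by simp
    then show "(\<Sum>b\<in>K. block_risk n (B b) \<sigma> T (spikes n \<tau> K \<phi>)) \<le> ?R"
      by (intro order_trans[OF risk_ge_sum_block_risk[OF T K(1) B]] SUP_upper)
  qed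
  also have "\<dots> = ennreal (real (card ?\<Phi>)) * ?R"
    by (simp add: ennreal_of_nat_eq_real_of_nat)
  finally show "ennreal (k * \<tau>\<^sup>2 * (1 - spike_gain \<mu> (m - 1))) \<le> ?R"
    using pos by (subst (asm) ennreal_mult_le_mult_iff) auto
qed

text \<open>Consecutive blocks are used; block \<open>b\<close> starts at \<open>b * m + 1\<close>
  because coordinates are numbered from 1, and the coordinates beyond \<open>k * m\<close> carry no
  spike.\<close>

lemma minimax_risk_sparse_ge:
  assumes m: "k * m \<le> n" "m \<ge> 2" and k: "k \<ge> 1"
    and \<sigma>: "\<sigma> > 0" and \<mu>: "\<mu> > 0" and \<tau>: "\<tau> = \<mu> * \<sigma>" and A: "A \<ge> 1"
  shows "ennreal (k * \<tau>\<^sup>2 * (1 - spike_gain \<mu> (m - 1))) \<le> minimax_risk n (sparse_space A n k \<tau>) \<sigma>"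
proof (rule minimax_risk_sparse_ge_blocks[where K = "{..<k}" and B = "\<lambda>b. {b * m + 1..b * m + m}"])
  have le: "b * m + m \<le> b' * m" if "b < b'" for b b' :: nat
    using mult_le_mono1[of "Suc b" b' m] that by simp
  show "disjoint_family_on (\<lambda>b. {b * m + 1..b * m + m}) {..<k}"
    unfolding disjoint_family_on_def
  proof (intro ballI impI)
    fix b b' :: nat assume "b \<noteq> b'"
    then show "{b * m + 1..b * m + m} \<inter> {b' * m + 1..b' * m + m} = {}"
      using le[of b b'] le[of b' b] by (cases "b < b'") auto
  qed
  show "{b * m + 1..b * m + m} \<subseteq> {1..n}" if "b \<in> {..<k}" for b
    using le[of b k] that m by auto
  show "1 \<le> n" using m mult_le_mono[of 1 k 1 m] k by linarith
qed (use assms in auto)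

section \<open>Asymptotics\<close>

text \<open>By the hypothesis on \<mu>, the exponential is \<epsilon> to a power tending to 0.
  Eventually it is at most \<open>1 / sqrt (\<epsilon> n)\<close>, which bounds the product by
  \<open>sqrt (\<epsilon> n)\<close>.\<close>

lemma tendsto_mult_exp_sq:
  fixes \<epsilon> \<mu> :: "nat \<Rightarrow> real"
  assumes pos: "\<forall>\<^sub>F n in sequentially. \<epsilon> n > 0" and \<epsilon>: "\<epsilon> \<longlonglongrightarrow> 0"
    and \<mu>: "(\<lambda>n. \<mu> n / sqrt (ln (1 / \<epsilon> n))) \<longlonglongrightarrow> 0" and c: "c > 0"
  shows "(\<lambda>n. \<epsilon> n * exp (c * (\<mu> n)\<^sup>2)) \<longlonglongrightarrow> 0"
proof (rule tendsto_sandwich[OF _ _ tendsto_const])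
  show "(\<lambda>n. sqrt (\<epsilon> n)) \<longlonglongrightarrow> 0"
    using tendsto_real_sqrt[OF \<epsilon>] by simp
  have lt1: "\<forall>\<^sub>F n in sequentially. \<epsilon> n < 1"
    using order_tendstoD(2)[OF \<epsilon>, of 1] by simp
  have "(\<lambda>n. (\<mu> n / sqrt (ln (1 / \<epsilon> n)))\<^sup>2) \<longlonglongrightarrow> 0"
    using tendsto_power[OF \<mu>, of 2] by simp
  \<comment> \<open>The threshold \<open>1 / (2 * c)\<close> makes
    \<open>c * (\<mu> n)\<^sup>2\<close> at most half of
    \<open>ln (1 / \<epsilon> n)\<close>.\<close>
  then have "\<forall>\<^sub>F n in sequentially. (\<mu> n / sqrt (ln (1 / \<epsilon> n)))\<^sup>2 < 1 / (2 * c)"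
    by (rule order_tendstoD(2)) (use c in simp)
  with lt1 pos show "\<forall>\<^sub>F n in sequentially. \<epsilon> n * exp (c * (\<mu> n)\<^sup>2) \<le> sqrt (\<epsilon> n)"
  proof eventually_elim
    case (elim n)
    have L: "ln (1 / \<epsilon> n) > 0" using elim by (intro ln_gt_zero) auto
    have "(\<mu> n)\<^sup>2 / ln (1 / \<epsilon> n) < 1 / (2 * c)"
      using elim L by (simp add: power_divide)
    then have "c * (\<mu> n)\<^sup>2 \<le> - ln (\<epsilon> n) / 2"
      using L c elim by (simp add: field_simps ln_div)
    then have "exp (c * (\<mu> n)\<^sup>2) \<le> exp (- ln (\<epsilon> n) / 2)" by simp
    then have "\<epsilon> n * exp (c * (\<mu> n)\<^sup>2) \<le> exp (ln (\<epsilon> n)) * exp (- ln (\<epsilon> n) / 2)"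
      using elim by (simp add: mult_left_mono)
    also have "\<dots> = exp (ln (\<epsilon> n) / 2)" by (simp flip: exp_add)
    also have "\<dots> = sqrt (\<epsilon> n)"
      using elim by (simp add: ln_sqrt[symmetric])
    finally show ?case .
  qed
  show "\<forall>\<^sub>F n in sequentially. 0 \<le> \<epsilon> n * exp (c * (\<mu> n)\<^sup>2)"
    using pos by eventually_elim auto
qed

section \<open>Risk bounds relative to the target correction term\<close>

lemma cosh_le_exp:
  fixes s :: real
  assumes "s \<ge> 0"
  shows "cosh s \<le> exp s"
proof -
  have "(a + b) / 2 \<le> a" if "b \<le> a" for a b :: real
    using that by simp
  moreover have "exp (- s) \<le> exp s" using assms by simp
  ultimately show ?thesis unfolding cosh_field_def by blast
qed

text \<open>The factor 1/2 comes from \<open>sinh\<close> and becomes the constant of the expansion.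
  The exponent \<open>3 / 2 * \<mu>\<^sup>2\<close> in the remainder is rounded up to
  \<open>2 * \<mu>\<^sup>2\<close>; \<open>tendsto_mult_exp_sq\<close> tolerates any positive
  constant there.\<close>

lemma spike_gain_le:
  assumes "q \<ge> 1"
  shows "spike_gain \<mu> q \<le> 1/2 * exp (\<mu>\<^sup>2) * (1 + exp (2 * \<mu>\<^sup>2) / q) / q"
proof -
  have "sinh (\<mu>\<^sup>2) \<le> 1/2 * exp (\<mu>\<^sup>2)" by (simp add: sinh_def)
  moreover have "exp (\<mu>\<^sup>2 / 2) * (cosh (\<mu>\<^sup>2) - 1) \<le> exp (\<mu>\<^sup>2) * exp (\<mu>\<^sup>2)"
  proof (intro mult_mono)
    show "cosh (\<mu>\<^sup>2) - 1 \<le> exp (\<mu>\<^sup>2)" using cosh_le_exp[of "\<mu>\<^sup>2"] by simp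
  qed (auto simp: cosh_real_ge_1)
  moreover have "exp (\<mu>\<^sup>2) * exp (\<mu>\<^sup>2) = exp (2 * \<mu>\<^sup>2)" by (simp flip: exp_add)
  ultimately show ?thesis
    unfolding spike_gain_def using assms
    by (intro divide_right_mono mult_mono add_left_mono add_nonneg_nonneg divide_nonneg_nonneg mult_nonneg_nonneg)
       (auto simp: cosh_real_ge_1)
qed

text \<open>The first bound supplies the condition \<open>small\<close> of
  \<open>minimax_risk_sparse_le\<close> at \<open>c = e\<close>, the second makes the risk bound
  obtained there nonnegative. Both rest on \<open>1 + s \<le> exp s\<close>.\<close>

lemma mult_sinh_cosh_le_1:
  fixes e s :: real
  assumes "s > 0" "e \<ge> 0" "e * exp (2 * s) \<le> 1"
  shows "e * (sinh s + s * cosh s) \<le> 1" "2 * e * sinh s \<le> 1"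
proof -
  have "cosh s \<le> exp s" "sinh s \<le> exp s"
    using cosh_le_exp[of s] sinh_le_cosh_real[of s] assms by linarith+
  then have "sinh s + s * cosh s \<le> exp s + s * exp s"
    using assms by (intro add_mono mult_left_mono) auto
  also have "\<dots> = (1 + s) * exp s" by (simp add: algebra_simps)
  also have "\<dots> \<le> exp s * exp s"
    by (intro mult_right_mono exp_ge_add_one_self) auto
  also have "\<dots> = exp (2 * s)" by (simp flip: exp_add)
  finally have "e * (sinh s + s * cosh s) \<le> e * exp (2 * s)"
    using assms by (intro mult_left_mono) auto
  then show 1: "e * (sinh s + s * cosh s) \<le> 1" using assms(3) by linarith
  have "2 * e * sinh s \<le> e * (sinh s + s * cosh s)"
    using mult_left_mono[OF sinh_le_mult_cosh[OF assms(1)] assms(2)] by (simp add: algebra_simps)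
  with 1 show "2 * e * sinh s \<le> 1" by linarith
qed

text \<open>In units of the target correction, the gain on the signal counts
  \<open>2 - 2 * exp (- 2 * s)\<close> and the noise cost \<open>1 + e * exp (2 * A * s)\<close>, so
  the net saving is 1 up to the stated errors. An upper bound on the risk bounds the relative error
  from below.\<close>

lemma excess_lower_bound:
  fixes A e s \<sigma> r N k :: real
  assumes N: "N > 0" and e: "e > 0" and s: "s > 0" and \<sigma>: "\<sigma> > 0" and k: "k = N * e"
    and r: "r \<le> \<sigma>\<^sup>2 * (k * s - 2 * e * k * s * sinh s + 1/2 * e\<^sup>2 * s * exp s * (N + k * exp (2 * A * s)))"
  shows "- 2 * exp (- 2 * s) - e * exp (2 * A * s) \<le>
    (N * \<sigma>\<^sup>2 * (e * s) - r) / (N * \<sigma>\<^sup>2 * (1/2 * e\<^sup>2 * s * exp s)) - 1"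
proof -
  let ?D = "N * \<sigma>\<^sup>2 * (1/2 * e\<^sup>2 * s * exp s)"
  have D: "?D > 0" using assms by simp
  have "exp s * exp (- 2 * s) = exp (- s)" by (simp flip: exp_add)
  then have "4 * sinh s = exp s * (2 - 2 * exp (- 2 * s))"
    by (simp add: sinh_def algebra_simps)
  then have eq: "\<sigma>\<^sup>2 * (2 * e * k * s * sinh s - 1/2 * e\<^sup>2 * s * exp s * (N + k * exp (2 * A * s))) =
     (1 - 2 * exp (- 2 * s) - e * exp (2 * A * s)) * ?D"
    unfolding k by algebra
  have "\<sigma>\<^sup>2 * (2 * e * k * s * sinh s - 1/2 * e\<^sup>2 * s * exp s * (N + k * exp (2 * A * s))) \<le> N * \<sigma>\<^sup>2 * (e * s) - r"
    using r by (simp add: k algebra_simps)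
  then have "1 - 2 * exp (- 2 * s) - e * exp (2 * A * s) \<le> (N * \<sigma>\<^sup>2 * (e * s) - r) / ?D"
    unfolding eq using D by (simp add: pos_le_divide_eq)
  then show ?thesis by linarith
qed

text \<open>Here \<open>q\<close> stands for the block length minus 1. The hypothesis on
  \<open>q\<close> gives \<open>1 / q \<le> e / (1 - 2 * e)\<close>, where \<open>e < 1/4\<close>
  keeps the denominator positive, and every \<open>1 / q\<close> in the gain is replaced by
  this.\<close>

lemma excess_upper_bound:
  fixes e s \<sigma> r N k q g :: real
  assumes N: "N > 0" and e: "0 < e" "e < 1/4" and s: "s > 0" and \<sigma>: "\<sigma> > 0" and k: "k = N * e"
    and q: "q \<ge> 1 / e - 2" and g: "g \<le> 1/2 * exp s * (1 + exp (2 * s) / q) / q"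
    and r: "k * (s * \<sigma>\<^sup>2) * (1 - g) \<le> r"
  shows "(N * \<sigma>\<^sup>2 * (e * s) - r) / (N * \<sigma>\<^sup>2 * (1/2 * e\<^sup>2 * s * exp s)) - 1 \<le>
    (1 + e * exp (2 * s) / (1 - 2 * e)) / (1 - 2 * e) - 1"
proof -
  let ?D = "N * \<sigma>\<^sup>2 * (1/2 * e\<^sup>2 * s * exp s)"
  have D: "?D > 0" using assms by simp
  have eq: "1 - 2 * e \<le> e * q" using q e by (simp add: field_simps)
  then have "e * q > 0" using e by linarith
  then have q0: "q > 0" using e by (simp add: zero_less_mult_iff)
  have inv: "1 / q \<le> e / (1 - 2 * e)"
    using eq e q0 by (simp add: field_simps)
  have "N * \<sigma>\<^sup>2 * (e * s) - r \<le> N * \<sigma>\<^sup>2 * (e * s) * g"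
    using r by (simp add: k algebra_simps)
  also have "\<dots> \<le> N * \<sigma>\<^sup>2 * (e * s) * (1/2 * exp s * (1 + exp (2 * s) * (1 / q)) * (1 / q))"
    using g N e s by (intro mult_left_mono) auto
  also have "\<dots> \<le> N * \<sigma>\<^sup>2 * (e * s) * (1/2 * exp s * (1 + exp (2 * s) * (e / (1 - 2 * e))) * (e / (1 - 2 * e)))"
    using inv N e s q0 by (intro mult_left_mono mult_mono add_left_mono mult_nonneg_nonneg add_nonneg_nonneg) auto
  also have "\<dots> = (1 + e * exp (2 * s) / (1 - 2 * e)) / (1 - 2 * e) * ?D"
    by (simp add: power2_eq_square mult_ac)
  finally have "(N * \<sigma>\<^sup>2 * (e * s) - r) / ?D \<le> (1 + e * exp (2 * s) / (1 - 2 * e)) / (1 - 2 * e)"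
    using D by (simp only: pos_divide_le_eq)
  then show ?thesis by linarith
qed

theorem theorem5:
  fixes k :: "nat \<Rightarrow> nat" and \<tau> \<sigma> \<epsilon> \<mu> :: "nat \<Rightarrow> real" and A :: real
  assumes k: "\<And>n. n \<ge> 1 \<Longrightarrow> 1 \<le> k n \<and> k n \<le> n"
    and \<tau>: "\<And>n. n \<ge> 1 \<Longrightarrow> \<tau> n > 0"
    and \<sigma>: "\<And>n. n \<ge> 1 \<Longrightarrow> \<sigma> n > 0"
    and \<epsilon>_def: "\<epsilon> = (\<lambda>n. real (k n) / real n)"
    and \<mu>_def: "\<mu> = (\<lambda>n. \<tau> n / \<sigma> n)"
    and \<epsilon>_lim: "\<epsilon> \<longlonglongrightarrow> 0"
    and \<mu>_lim: "filterlim \<mu> at_top sequentially"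
    and \<mu>_small: "(\<lambda>n. \<mu> n / sqrt (ln (1 / \<epsilon> n))) \<longlonglongrightarrow> 0"
    and A: "A > 1"
  shows "\<exists>\<delta>::nat \<Rightarrow> real. \<delta> \<longlonglongrightarrow> 0 \<and>
    (\<forall>n\<ge>1. enn2ereal (minimax_risk n (sparse_space A n (k n) (\<tau> n)) (\<sigma> n)) =
      ereal (real n * (\<sigma> n)\<^sup>2 *
        (\<epsilon> n * (\<mu> n)\<^sup>2 - 1 / 2 * (\<epsilon> n)\<^sup>2 * (\<mu> n)\<^sup>2 * exp ((\<mu> n)\<^sup>2) * (1 + \<delta> n))))"
proof -
  define r where "r n = enn2real (minimax_risk n (sparse_space A n (k n) (\<tau> n)) (\<sigma> n))" for n
  define D where "D n = real n * (\<sigma> n)\<^sup>2 * (1/2 * (\<epsilon> n)\<^sup>2 * (\<mu> n)\<^sup>2 * exp ((\<mu> n)\<^sup>2))" for n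
  \<comment> \<open>Solving the claimed expansion for its error term makes it exact for every
    \<open>n \<ge> 1\<close>; what remains is the limit of \<open>\<delta>\<close>.\<close>
  define \<delta> where "\<delta> n = (real n * (\<sigma> n)\<^sup>2 * (\<epsilon> n * (\<mu> n)\<^sup>2) - r n) / D n - 1" for n
  have pos: "\<epsilon> n > 0" "\<mu> n > 0" "\<tau> n = \<mu> n * \<sigma> n" "real (k n) = real n * \<epsilon> n" if "n \<ge> 1" for n
    using k[OF that] \<tau>[OF that] \<sigma>[OF that] that by (auto simp: \<epsilon>_def \<mu>_def)
  have enn: "minimax_risk n (sparse_space A n (k n) (\<tau> n)) (\<sigma> n) = ennreal (r n)" for n
    unfolding r_def
    using minimax_risk_sparse_le_trivial[of n A "k n" "\<tau> n" "\<sigma> n"]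
    by (intro ennreal_enn2real[symmetric]) (auto intro: order.strict_trans1)
  have r0: "r n \<ge> 0" for n by (simp add: r_def)
  have expansion: "enn2ereal (minimax_risk n (sparse_space A n (k n) (\<tau> n)) (\<sigma> n)) =
      ereal (real n * (\<sigma> n)\<^sup>2 *
        (\<epsilon> n * (\<mu> n)\<^sup>2 - 1 / 2 * (\<epsilon> n)\<^sup>2 * (\<mu> n)\<^sup>2 * exp ((\<mu> n)\<^sup>2) * (1 + \<delta> n)))" if n: "n \<ge> 1" for n
  proof -
    have "D n > 0" using pos[OF n] \<sigma>[OF n] n by (simp add: D_def)
    then have "r n = real n * (\<sigma> n)\<^sup>2 * (\<epsilon> n * (\<mu> n)\<^sup>2) - D n * (1 + \<delta> n)"
      by (simp add: \<delta>_def)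
    also have "\<dots> = real n * (\<sigma> n)\<^sup>2 *
        (\<epsilon> n * (\<mu> n)\<^sup>2 - 1 / 2 * (\<epsilon> n)\<^sup>2 * (\<mu> n)\<^sup>2 * exp ((\<mu> n)\<^sup>2) * (1 + \<delta> n))"
      by (simp add: D_def right_diff_distrib)
    finally show ?thesis using r0[of n] by (simp add: enn enn2ereal_ennreal)
  qed
  have ev1: "\<forall>\<^sub>F n in sequentially. n \<ge> 1" by (rule eventually_ge_at_top)
  have ev_pos: "\<forall>\<^sub>F n in sequentially. \<epsilon> n > 0"
    using ev1 by eventually_elim (rule pos)
  note exp_small = tendsto_mult_exp_sq[OF ev_pos \<epsilon>_lim \<mu>_small]
  let ?lo = "\<lambda>n. - 2 * exp (- 2 * (\<mu> n)\<^sup>2) - \<epsilon> n * exp (2 * A * (\<mu> n)\<^sup>2)"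
  let ?hi = "\<lambda>n. (1 + \<epsilon> n * exp (2 * (\<mu> n)\<^sup>2) / (1 - 2 * \<epsilon> n)) / (1 - 2 * \<epsilon> n) - 1"
  have "\<delta> \<longlonglongrightarrow> 0"
  proof (rule tendsto_sandwich)
    have "filterlim (\<lambda>n. (\<mu> n)\<^sup>2) at_top sequentially"
      using \<mu>_lim by (intro filterlim_pow_at_top) auto
    then have "filterlim (\<lambda>n. - 2 * (\<mu> n)\<^sup>2) at_bot sequentially"
      by (intro filterlim_tendsto_neg_mult_at_bot[OF tendsto_const]) auto
    then have "(\<lambda>n. exp (- 2 * (\<mu> n)\<^sup>2)) \<longlonglongrightarrow> 0"
      by (rule filterlim_compose[OF exp_at_bot])
    moreover have "(\<lambda>n. \<epsilon> n * exp (2 * A * (\<mu> n)\<^sup>2)) \<longlonglongrightarrow> 0"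
      using A by (intro exp_small) auto
    ultimately have "?lo \<longlonglongrightarrow> - 2 * 0 - 0" by (intro tendsto_intros)
    then show "?lo \<longlonglongrightarrow> 0" by simp
    have "(\<lambda>n. \<epsilon> n * exp (2 * (\<mu> n)\<^sup>2)) \<longlonglongrightarrow> 0" by (intro exp_small) auto
    then have "?hi \<longlonglongrightarrow> (1 + 0 / (1 - 2 * 0)) / (1 - 2 * 0) - 1"
      by (intro tendsto_intros \<epsilon>_lim) auto
    then show "?hi \<longlonglongrightarrow> 0" by simp
    have ev2: "\<forall>\<^sub>F n in sequentially. \<epsilon> n * exp (2 * (\<mu> n)\<^sup>2) < 1"
      using exp_small[of 2] by (intro order_tendstoD) auto
    \<comment> \<open>The threshold 1/4 forces blocks of length greater than 3, so that
      \<open>m \<ge> 2\<close> below.\<close>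
    have ev3: "\<forall>\<^sub>F n in sequentially. \<epsilon> n < 1/4"
      using \<epsilon>_lim by (intro order_tendstoD) auto
    \<comment> \<open>Uses the upper bound on the risk, from the estimator with
      \<open>c = \<epsilon> n\<close>.\<close>
    show "\<forall>\<^sub>F n in sequentially. ?lo n \<le> \<delta> n"
      using ev1 ev2
    proof eventually_elim
      case (elim n)
      note p = pos[OF elim(1)]
      let ?x = "(\<sigma> n)\<^sup>2 * (real (k n) * (\<mu> n)\<^sup>2 - 2 * \<epsilon> n * real (k n) * (\<mu> n)\<^sup>2 * sinh ((\<mu> n)\<^sup>2) +
        1/2 * (\<epsilon> n)\<^sup>2 * (\<mu> n)\<^sup>2 * exp ((\<mu> n)\<^sup>2) * (real n + real (k n) * exp (2 * A * (\<mu> n)\<^sup>2)))"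
      have s: "(\<mu> n)\<^sup>2 > 0" using p by simp
      have small: "\<epsilon> n * (sinh ((\<mu> n)\<^sup>2) + (\<mu> n)\<^sup>2 * cosh ((\<mu> n)\<^sup>2)) \<le> 1" "2 * \<epsilon> n * sinh ((\<mu> n)\<^sup>2) \<le> 1"
        using mult_sinh_cosh_le_1[OF s, of "\<epsilon> n"] p elim by auto
      have "ennreal (r n) \<le> ennreal ?x"
        unfolding enn[symmetric]
        by (intro minimax_risk_sparse_le \<sigma> elim(1) p small(1)) (use p A in auto)
      \<comment> \<open>Needed to remove \<open>ennreal\<close> from the inequality, since a
        negative bound would be truncated to 0.\<close>
      moreover have "?x \<ge> 0"
      proof -
        have "real (k n) * (\<mu> n)\<^sup>2 * (2 * \<epsilon> n * sinh ((\<mu> n)\<^sup>2)) \<le> real (k n) * (\<mu> n)\<^sup>2 * 1"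
          using small(2) by (intro mult_left_mono) auto
        then show ?thesis
          by (intro mult_nonneg_nonneg add_nonneg_nonneg) (auto simp: algebra_simps)
      qed
      ultimately have "r n \<le> ?x" by simp
      then show ?case
        unfolding \<delta>_def D_def using elim p \<sigma>[OF elim(1)] s
        by (intro excess_lower_bound[where k = "real (k n)"]) auto
    qed
    \<comment> \<open>Uses the lower bound on the risk, from \<open>k n\<close> blocks of length
      \<open>n div k n\<close>.\<close>
    show "\<forall>\<^sub>F n in sequentially. \<delta> n \<le> ?hi n"
      using ev1 ev3
    proof eventually_elim
      case (elim n)
      note p = pos[OF elim(1)]
      have s: "(\<mu> n)\<^sup>2 > 0" using p by simp
      define m where "m = n div k n"
      have k1: "k n \<ge> 1" using k[OF elim(1)] by simp
      have "real n < real (k n) * (real m + 1)"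
      proof -
        have "n < k n * (m + 1)"
          using k1 dividend_less_times_div[of "k n" n] by (simp add: m_def)
        then have "real n < real (k n * (m + 1))" by (simp only: of_nat_less_iff)
        then show ?thesis by (simp add: distrib_left)
      qed
      \<comment> \<open>Rounding down costs less than 1 in the block length; the coordinate left out
        of the denominator costs another 1, whence the \<open>- 2\<close> in
        \<open>q\<close>.\<close>
      then have mlow: "real m > 1 / \<epsilon> n - 1"
        using k1 elim(1) by (simp add: \<epsilon>_def field_simps)
      moreover have "1 / \<epsilon> n > 4" using elim(2) p(1) by (simp add: field_simps)
      ultimately have "real m > 3" by linarith
      then have m: "m \<ge> 2" by linarith
      have "ennreal (k n * (\<tau> n)\<^sup>2 * (1 - spike_gain (\<mu> n) (m - 1))) \<le> ennreal (r n)"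
        unfolding enn[symmetric]
        using A by (intro minimax_risk_sparse_ge m k1 p \<sigma> elim(1)) (auto simp: m_def)
      then have "k n * (\<tau> n)\<^sup>2 * (1 - spike_gain (\<mu> n) (m - 1)) \<le> r n"
        using r0[of n] by (simp add: ennreal_le_iff)
      then have r: "real (k n) * ((\<mu> n)\<^sup>2 * (\<sigma> n)\<^sup>2) * (1 - spike_gain (\<mu> n) (m - 1)) \<le> r n"
        by (simp add: p(3) power_mult_distrib)
      have g: "spike_gain (\<mu> n) (m - 1) \<le> 1/2 * exp ((\<mu> n)\<^sup>2) * (1 + exp (2 * (\<mu> n)\<^sup>2) / real (m - 1)) / real (m - 1)"
        using m by (intro spike_gain_le) auto
      have q: "real (m - 1) \<ge> 1 / \<epsilon> n - 2" using mlow m by simp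
      show ?case
        unfolding \<delta>_def D_def
        by (rule excess_upper_bound[OF _ p(1) elim(2) s \<sigma>[OF elim(1)] p(4) q g r]) (use elim in simp)
    qed
  qed
  then show ?thesis using expansion by blast
qed

end
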